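(* Let $V$ be a finitely generated $k\mathfrak{S}_n$-module with canonical decomposition $V\cong\bigoplus_{i=1}^t n_i V_i$, where $V_1,\dots,V_t$ is a complete set of representatives of the isomorphism classes of simple $k\mathfrak{S}_n$-modules and $n_iV_i$ denotes the direct sum of $n_i$ copies of $V_i$. Then every maximal $r$-generated submodule of $V$ is isomorphic to $$\bigoplus_{i=1}^t \min\{n_i,\; r\cdot\dim_k V_i\}\, V_i.$$ In particular, maximal $r$-generated submodules of $V$ exist and are unique up to isomorphism.
   Context: $\mathfrak{S}_n$ is the symmetric group on $n$ letters and $k$ is an infinite field with $\operatorname{char}(k)=0$ or $\operatorname{char}(k)>n$. A $k\mathfrak{S}_n$-module $M$ is $r$-generated if there exist $f_1,\dots,f_r\in M$ (not necessarily distinct or nonzero) generating $M$ as a $k\mathfrak{S}_n$-module. A maximal $r$-generated submodule of $V$ is an $r$-generated $k\mathfrak{S}_n$-submodule of $V$ that is not contained in any other $r$-generated $k\mathfrak{S}_n$-submodule of $V$. *)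

theory Defs
  imports Complex_Main "HOL-Combinatorics.Permutations" "HOL-Library.Function_Algebras"
begin

text \<open>
  A module over the group algebra of the symmetric group on the letters \<open>1, \<dots>, n\<close> is a vector
  space over the field \<open>'k\<close> with a linear action of the permutations of \<open>{1..n}\<close>.  Scalars act on
  all of the type \<open>'v\<close>, of which the module is a subspace; this makes the library's \<open>subspace\<close>,
  \<open>span\<close> and \<open>dim\<close> available for it.  The action is only constrained for permutations of \<open>{1..n}\<close>
  and for elements of the module.
\<close>

record ('k, 'v) perm_module =
  underlying :: "'v set"
  scal :: "'k \<Rightarrow> 'v \<Rightarrow> 'v"
  act :: "(nat \<Rightarrow> nat) \<Rightarrow> 'v \<Rightarrow> 'v"

locale Sn_module = vector_space "scal M"
  for n :: nat and M :: "('k::field, 'v::ab_group_add) perm_module" +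
  assumes subspace_underlying: "subspace (underlying M)"
    and act_closed: "\<lbrakk>p permutes {1..n}; v \<in> underlying M\<rbrakk> \<Longrightarrow> act M p v \<in> underlying M"
    and act_add: "\<lbrakk>p permutes {1..n}; u \<in> underlying M; v \<in> underlying M\<rbrakk>
      \<Longrightarrow> act M p (u + v) = act M p u + act M p v"
    and act_scal: "\<lbrakk>p permutes {1..n}; v \<in> underlying M\<rbrakk>
      \<Longrightarrow> act M p (scal M c v) = scal M c (act M p v)"
    and act_id: "v \<in> underlying M \<Longrightarrow> act M id v = v"
    and act_comp: "\<lbrakk>p permutes {1..n}; q permutes {1..n}; v \<in> underlying M\<rbrakk>
      \<Longrightarrow> act M (p \<circ> q) v = act M p (act M q v)"

definition Sn_dim :: "('k::field, 'v::ab_group_add) perm_module \<Rightarrow> nat" where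
  "Sn_dim M = vector_space.dim (scal M) (underlying M)"

text \<open>
  A submodule is given by its underlying set \<open>W\<close>; as a module in its own right it is
  \<open>M\<lparr>underlying := W\<rparr>\<close>.
\<close>

definition Sn_submodule ::
  "nat \<Rightarrow> ('k::field, 'v::ab_group_add) perm_module \<Rightarrow> 'v set \<Rightarrow> bool" where
  "Sn_submodule n M W \<longleftrightarrow> W \<subseteq> underlying M \<and> module.subspace (scal M) W \<and>
     (\<forall>p w. p permutes {1..n} \<longrightarrow> w \<in> W \<longrightarrow> act M p w \<in> W)"

definition Sn_simple :: "nat \<Rightarrow> ('k::field, 'v::ab_group_add) perm_module \<Rightarrow> bool" where
  "Sn_simple n M \<longleftrightarrow> Sn_module n M \<and> underlying M \<noteq> {0} \<and>
     (\<forall>W. Sn_submodule n M W \<longrightarrow> W = {0} \<or> W = underlying M)"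

definition Sn_iso :: "nat \<Rightarrow> ('k::field, 'v::ab_group_add) perm_module
    \<Rightarrow> ('k, 'w::ab_group_add) perm_module \<Rightarrow> bool" where
  "Sn_iso n M N \<longleftrightarrow> (\<exists>f. bij_betw f (underlying M) (underlying N) \<and>
     (\<forall>u\<in>underlying M. \<forall>v\<in>underlying M. f (u + v) = f u + f v) \<and>
     (\<forall>c. \<forall>v\<in>underlying M. f (scal M c v) = scal N c (f v)) \<and>
     (\<forall>p. p permutes {1..n} \<longrightarrow> (\<forall>v\<in>underlying M. f (act M p v) = act N p (f v))))"

text \<open>The submodule generated by a set \<open>F\<close> of elements of \<open>M\<close> is \<open>Sn_submodule n M hull F\<close>.\<close>

definition Sn_generated :: "nat \<Rightarrow> nat \<Rightarrow> ('k::field, 'v::ab_group_add) perm_module \<Rightarrow> bool" where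
  "Sn_generated n r M \<longleftrightarrow> (\<exists>f :: nat \<Rightarrow> 'v. (\<forall>i\<in>{1..r}. f i \<in> underlying M) \<and>
     Sn_submodule n M hull (f ` {1..r}) = underlying M)"

definition Sn_finitely_generated ::
  "nat \<Rightarrow> ('k::field, 'v::ab_group_add) perm_module \<Rightarrow> bool" where
  "Sn_finitely_generated n M \<longleftrightarrow> (\<exists>r. Sn_generated n r M)"

definition Sn_generated_submodule ::
  "nat \<Rightarrow> nat \<Rightarrow> ('k::field, 'v::ab_group_add) perm_module \<Rightarrow> 'v set \<Rightarrow> bool" where
  "Sn_generated_submodule n r M W \<longleftrightarrow>
     Sn_submodule n M W \<and> Sn_generated n r (M\<lparr>underlying := W\<rparr>)"

definition Sn_maximal_generated_submodule ::
  "nat \<Rightarrow> nat \<Rightarrow> ('k::field, 'v::ab_group_add) perm_module \<Rightarrow> 'v set \<Rightarrow> bool" where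
  "Sn_maximal_generated_submodule n r M W \<longleftrightarrow> Sn_generated_submodule n r M W \<and>
     (\<forall>W'. Sn_generated_submodule n r M W' \<longrightarrow> W \<subseteq> W' \<longrightarrow> W' = W)"

text \<open>
  The external direct sum of \<open>m i\<close> copies of \<open>S i\<close> for each \<open>i\<close>, with pointwise operations: the
  component of \<open>f\<close> in the \<open>j\<close>-th copy of \<open>S i\<close> is \<open>f (i, j)\<close>, where \<open>j < m i\<close>.
\<close>

definition Sn_dsum :: "('i \<Rightarrow> nat) \<Rightarrow> ('i \<Rightarrow> ('k::field, 'w::ab_group_add) perm_module)
    \<Rightarrow> ('k, 'i \<times> nat \<Rightarrow> 'w) perm_module" where
  "Sn_dsum m S = \<lparr>
     underlying = {f. \<forall>i j. if j < m i then f (i, j) \<in> underlying (S i) else f (i, j) = 0},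
     scal = (\<lambda>c f (i, j). scal (S i) c (f (i, j))),
     act = (\<lambda>p f (i, j). act (S i) p (f (i, j)))\<rparr>"

text \<open>
  Complete sets of representatives of the isomorphism classes of simple modules.  Completeness has
  to be tested on simple modules over a fixed type; \<open>nat \<Rightarrow> 'k\<close> contains all coordinate spaces,
  hence up to isomorphism all simple modules, so this covers simple modules over every type: see
  \<open>Sn_simple_reps_complete\<close> below.
\<close>

definition Sn_simple_reps ::
  "nat \<Rightarrow> ('i \<Rightarrow> ('k::field, 'w::ab_group_add) perm_module) \<Rightarrow> bool" where
  "Sn_simple_reps n S \<longleftrightarrow> (\<forall>i. Sn_simple n (S i)) \<and>
     (\<forall>i j. Sn_iso n (S i) (S j) \<longrightarrow> i = j) \<and>
     (\<forall>N :: ('k, nat \<Rightarrow> 'k) perm_module. Sn_simple n N \<longrightarrow> (\<exists>i. Sn_iso n N (S i)))"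

lemma Sn_submodule_module:
  assumes "Sn_module n M" "Sn_submodule n M W"
  shows "Sn_module n (M\<lparr>underlying := W\<rparr>)"
proof -
  interpret Sn_module n M by fact
  have W: "W \<subseteq> underlying M" "subspace W"
    "\<And>p w. p permutes {1..n} \<Longrightarrow> w \<in> W \<Longrightarrow> act M p w \<in> W"
    using assms(2) by (auto simp: Sn_submodule_def)
  have vs: "vector_space (scal (M\<lparr>underlying := W\<rparr>))"
    using vector_space_axioms by simp
  show ?thesis
    by (rule Sn_module.intro[OF vs], unfold_locales)
      (use W act_add act_scal act_id act_comp in \<open>auto simp: subset_iff\<close>)
qed

lemma Sn_dsum_module:
  assumes "\<And>i. Sn_module n (S i)"
  shows "Sn_module n (Sn_dsum m S)"
proof -
  have vs0: "\<And>i. vector_space (scal (S i))"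
    using assms by (simp add: Sn_module_def)
  have vs: "vector_space (scal (Sn_dsum m S))"
    by (unfold_locales)
      (auto simp: Sn_dsum_def fun_eq_iff vector_space.vector_space_assms[OF vs0])
  have sub: "\<And>i. module.subspace (scal (S i)) (underlying (S i))"
    using assms by (rule Sn_module.subspace_underlying)
  have mo: "\<And>i. module (scal (S i))"
    using vs0 by (simp add: module_iff_vector_space)
  have z: "act (S i) p 0 = 0" if "p permutes {1..n}" for i p
    using Sn_module.act_add[OF assms that, of 0 i 0] module.subspace_0[OF mo sub] by simp
  have sz: "scal (S i) c 0 = 0" for i c
    by (rule module.scale_zero_right[OF mo])
  have comp: "f (i, j) \<in> underlying (S i)" if "f \<in> underlying (Sn_dsum m S)" for f i j
    using that module.subspace_0[OF mo sub, of i]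
    by (cases "j < m i") (auto simp: Sn_dsum_def dest: spec[of _ i])
  have act: "act (Sn_dsum m S) p f (i, j) = act (S i) p (f (i, j))" for p f i j
    by (simp add: Sn_dsum_def)
  have scal: "scal (Sn_dsum m S) c f (i, j) = scal (S i) c (f (i, j))" for c f i j
    by (simp add: Sn_dsum_def)
  have mo': "module (scal (Sn_dsum m S))"
    using vs by (simp add: module_iff_vector_space)
  show ?thesis
  proof (rule Sn_module.intro[OF vs], unfold_locales)
    show "module.subspace (scal (Sn_dsum m S)) (underlying (Sn_dsum m S))"
      unfolding module.subspace_def[OF mo']
      using module.subspace_0[OF mo sub] module.subspace_add[OF mo sub]
        module.subspace_scale[OF mo sub] sz
      by (auto simp: Sn_dsum_def)
  next
    fix p v assume "p permutes {1..n}" "v \<in> underlying (Sn_dsum m S)"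
    then show "act (Sn_dsum m S) p v \<in> underlying (Sn_dsum m S)"
      using Sn_module.act_closed[OF assms] z by (auto simp: Sn_dsum_def)
  qed (rule ext, simp only: split_paired_all act scal comp plus_fun_apply comp_apply
      Sn_module.act_id[OF assms] Sn_module.act_add[OF assms] Sn_module.act_scal[OF assms]
      Sn_module.act_comp[OF assms])+
qed

lemma Sn_transport:
  fixes N :: "('k::field, 'x::ab_group_add) perm_module" and h :: "'x \<Rightarrow> 'y::ab_group_add"
  assumes N: "Sn_module n N" and s: "vector_space s" and inj: "inj_on h (underlying N)"
    and add: "\<And>u v. \<lbrakk>u \<in> underlying N; v \<in> underlying N\<rbrakk> \<Longrightarrow> h (u + v) = h u + h v"
    and scale: "\<And>c v. v \<in> underlying N \<Longrightarrow> h (scal N c v) = s c (h v)"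
  defines "N' \<equiv> \<lparr>underlying = h ` underlying N, scal = s,
      act = (\<lambda>p y. h (act N p (inv_into (underlying N) h y)))\<rparr>"
  shows "Sn_module n N'" and "Sn_iso n N N'" and "Sn_simple n N \<Longrightarrow> Sn_simple n N'"
proof -
  interpret N: Sn_module n N by fact
  let ?U = "underlying N"
  have ms: "module s" using s by (simp add: module_iff_vector_space)
  note U0 = N.subspace_0[OF N.subspace_underlying]
  note Ua = N.subspace_add[OF N.subspace_underlying]
  note Us = N.subspace_scale[OF N.subspace_underlying]
  have inv [simp]: "inv_into ?U h (h u) = u" if "u \<in> ?U" for u
    using inv_into_f_f[OF inj that] .
  have h0: "h 0 = 0" using add[OF U0 U0] by simp
  have vs: "vector_space (scal N')" by (simp add: N'_def s)
  have U': "underlying N' = h ` ?U" and s': "scal N' = s"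
    and act': "\<And>p u. u \<in> ?U \<Longrightarrow> act N' p (h u) = h (act N p u)"
    by (simp_all add: N'_def)
  show mod: "Sn_module n N'"
  proof (rule Sn_module.intro[OF vs], unfold_locales)
    show "module.subspace (scal N') (underlying N')"
      unfolding s' U' module.subspace_def[OF ms]
      by (auto simp: add[symmetric] scale[symmetric] Ua Us intro: image_eqI[where x = 0] h0[symmetric] U0)
  qed (auto simp: U' s' act' add[symmetric] scale[symmetric] Ua Us N.act_closed N.act_add
      N.act_scal N.act_id N.act_comp)
  show "Sn_iso n N N'"
    unfolding Sn_iso_def
    by (rule exI[of _ h]) (auto simp: U' s' act' add scale bij_betw_def inj)
  show "Sn_simple n N'" if simple: "Sn_simple n N"
    unfolding Sn_simple_def
  proof (intro conjI allI impI mod)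
    have "?U \<noteq> {0}" using simple by (simp add: Sn_simple_def)
    then obtain u where u: "u \<in> ?U" "u \<noteq> 0" using U0 by blast
    then have "h u \<noteq> 0" using inj U0 h0 by (metis inj_onD)
    then show "underlying N' \<noteq> {0}" using u by (auto simp: U')
    fix W assume W: "Sn_submodule n N' W"
    define X where "X = {u \<in> ?U. h u \<in> W}"
    have Wsub: "W \<subseteq> h ` ?U" and Wss: "module.subspace s W"
      and Wact: "\<And>p w. p permutes {1..n} \<Longrightarrow> w \<in> W \<Longrightarrow> act N' p w \<in> W"
      using W by (auto simp: Sn_submodule_def U' s')
    have WX: "W = h ` X" using Wsub by (auto simp: X_def)
    have "N.subspace X"
      unfolding N.subspace_def using Wss[unfolded module.subspace_def[OF ms]]
      by (auto simp: X_def U0 h0 Ua Us add scale)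
    moreover have "act N p u \<in> X" if "p permutes {1..n}" "u \<in> X" for p u
      using that Wact[of p "h u"] by (auto simp: X_def act' N.act_closed)
    ultimately have "Sn_submodule n N X" by (auto simp: Sn_submodule_def X_def)
    then have "X = {0} \<or> X = ?U" using simple by (simp add: Sn_simple_def)
    then show "W = {0} \<or> W = underlying N'" by (auto simp: WX U' h0)
  qed
qed

lemma Sn_iso_trans:
  assumes N: "Sn_module n N" and "Sn_iso n N P" "Sn_iso n P Q"
  shows "Sn_iso n N Q"
proof -
  obtain f where f: "bij_betw f (underlying N) (underlying P)"
    "\<forall>u\<in>underlying N. \<forall>v\<in>underlying N. f (u + v) = f u + f v"
    "\<forall>c. \<forall>v\<in>underlying N. f (scal N c v) = scal P c (f v)"
    "\<forall>p. p permutes {1..n} \<longrightarrow> (\<forall>v\<in>underlying N. f (act N p v) = act P p (f v))"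
    using assms(2) unfolding Sn_iso_def by blast
  obtain g where g: "bij_betw g (underlying P) (underlying Q)"
    "\<forall>u\<in>underlying P. \<forall>v\<in>underlying P. g (u + v) = g u + g v"
    "\<forall>c. \<forall>v\<in>underlying P. g (scal P c v) = scal Q c (g v)"
    "\<forall>p. p permutes {1..n} \<longrightarrow> (\<forall>v\<in>underlying P. g (act P p v) = act Q p (g v))"
    using assms(3) unfolding Sn_iso_def by blast
  have "f u \<in> underlying P" if "u \<in> underlying N" for u
    using f(1) that by (auto simp: bij_betw_def)
  then show ?thesis
    unfolding Sn_iso_def using bij_betw_trans[OF f(1) g(1)] f(2-4) g(2-4)
    by (intro exI[of _ "g \<circ> f"]) simp
qed

lemma Sn_simple_coordinates:
  fixes N :: "('k::field, 'x::ab_group_add) perm_module"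
  assumes "Sn_simple n N"
  shows "\<exists>N' :: ('k, nat \<Rightarrow> 'k) perm_module. Sn_simple n N' \<and> Sn_iso n N N'"
proof -
  have N: "Sn_module n N" using assms by (simp add: Sn_simple_def)
  interpret N: Sn_module n N by fact
  let ?U = "underlying N"
  have "?U \<noteq> {0}" using assms by (simp add: Sn_simple_def)
  then obtain v where v: "v \<in> ?U" "v \<noteq> 0"
    using N.subspace_0[OF N.subspace_underlying] by blast
  define B where "B = (\<lambda>p. act N p v) ` {p. p permutes {1..n}}"
  have finB: "finite B" unfolding B_def by (intro finite_imageI finite_permutations) simp
  have BU: "B \<subseteq> ?U" using v by (auto simp: B_def N.act_closed)
  have spBU: "N.span B \<subseteq> ?U" by (rule N.span_minimal[OF BU N.subspace_underlying])
  have "act N p w \<in> N.span B" if p: "p permutes {1..n}" and w: "w \<in> N.span B" for p w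
  proof -
    have z: "act N p 0 = 0"
      using N.act_add[OF p, of 0 0] N.subspace_0[OF N.subspace_underlying] by simp
    have "w \<in> ?U \<and> act N p w \<in> N.span B"
      using w
    proof (induction w rule: N.span_induct_alt)
      case base
      then show ?case using N.subspace_0[OF N.subspace_underlying] by (simp add: z N.span_zero)
    next
      case (step c x y)
      obtain q where q: "q permutes {1..n}" "x = act N q v"
        using step(1) by (auto simp: B_def)
      have "act N p x = act N (p \<circ> q) v" using q p v by (simp add: N.act_comp)
      moreover have "p \<circ> q permutes {1..n}" using p q by (simp add: permutes_compose)
      ultimately have "act N p x \<in> N.span B" by (auto simp: B_def intro: N.span_base)
      moreover have xU: "x \<in> ?U" using step(1) BU by blast
      ultimately show ?case
        using step p
        by (simp add: N.act_add N.act_scal N.subspace_scale[OF N.subspace_underlying]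
            N.subspace_add[OF N.subspace_underlying] N.span_add N.span_scale)
    qed
    then show ?thesis ..
  qed
  then have "Sn_submodule n N (N.span B)"
    using spBU by (auto simp: Sn_submodule_def)
  moreover have "v \<in> N.span B"
    using v by (auto simp: B_def N.act_id intro!: N.span_base image_eqI[where x = id])
  ultimately have UB: "?U = N.span B" using assms v by (auto simp: Sn_simple_def)
  obtain C where C: "C \<subseteq> B" "N.independent C" "B \<subseteq> N.span C"
    using N.maximal_independent_subset by blast
  have UC: "?U = N.span C"
    using C UB by (metis N.span_eq N.span_mono N.span_span order.trans)
  have finC: "finite C" using C(1) finB finite_subset by blast
  obtain e where e: "bij_betw e {..<card C} C"
    using ex_bij_betw_nat_finite[OF finC] unfolding atLeast0LessThan by blast
  define s :: "'k \<Rightarrow> (nat \<Rightarrow> 'k) \<Rightarrow> (nat \<Rightarrow> 'k)" where "s = (\<lambda>c f i. c * f i)"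
  define h :: "'x \<Rightarrow> nat \<Rightarrow> 'k" where
    "h = (\<lambda>u i. if i < card C then N.representation C u (e i) else 0)"
  have s: "vector_space s" by unfold_locales (simp_all add: s_def fun_eq_iff algebra_simps)
  have inj: "inj_on h ?U"
  proof
    fix x y assume xy: "x \<in> ?U" "y \<in> ?U" "h x = h y"
    have "N.representation C x b = N.representation C y b" for b
    proof (cases "b \<in> C")
      case True
      then obtain i where i: "i < card C" "b = e i"
        using e by (auto simp: bij_betw_def)
      then show ?thesis using fun_cong[OF xy(3), of i] by (simp add: h_def)
    next
      case False
      then show ?thesis using N.representation_ne_zero by metis
    qed
    then have rep: "N.representation C x = N.representation C y" by blast
    have "x = (\<Sum>b\<in>C. scal N (N.representation C x b) b)"
      using N.sum_representation_eq[OF C(2) _ finC subset_refl, of x] xy(1) UC by simp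
    also have "\<dots> = y"
      unfolding rep using N.sum_representation_eq[OF C(2) _ finC subset_refl, of y] xy(2) UC by simp
    finally show "x = y" .
  qed
  have add: "h (u + w) = h u + h w" if "u \<in> ?U" "w \<in> ?U" for u w
    using that by (auto simp: h_def UC fun_eq_iff N.representation_add[OF C(2)])
  have scale: "h (scal N c u) = s c (h u)" if "u \<in> ?U" for c u
    using that by (auto simp: h_def s_def UC fun_eq_iff N.representation_scale[OF C(2)])
  show ?thesis
    using Sn_transport(2,3)[OF N s inj add scale] assms by blast
qed

theorem Sn_simple_reps_complete:
  fixes N :: "('k::field, 'x::ab_group_add) perm_module"
    and S :: "'i \<Rightarrow> ('k, 'w::ab_group_add) perm_module"
  assumes "Sn_simple_reps n S" and "Sn_simple n N"
  shows "\<exists>i. Sn_iso n N (S i)"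
proof -
  obtain N' :: "('k, nat \<Rightarrow> 'k) perm_module" where N': "Sn_simple n N'" "Sn_iso n N N'"
    using Sn_simple_coordinates[OF assms(2)] by blast
  with assms(1) obtain i where "Sn_iso n N' (S i)" by (auto simp: Sn_simple_reps_def)
  then show ?thesis
    using Sn_iso_trans[of n N N' "S i"] N' assms(2) by (auto simp: Sn_simple_def)
qed

end

theory Submission
  imports Defs
begin

text \<open>
  The modules are direct sums of simple modules, so up to isomorphism only multiplicities matter, and
  the question is for which multiplicities \<open>l i\<close> the sum of \<open>l i\<close> copies of each \<open>S i\<close> can be
  generated by \<open>r\<close> elements.  The components of \<open>r\<close> elements at the copies of \<open>S i\<close> are \<open>l i\<close> vectors of
  \<open>(S i)\<^sup>r\<close>.  A nontrivial linear relation between them is a nonzero homomorphism to \<open>S i\<close> that kills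
  the \<open>r\<close> elements; hence \<open>l i \<le> r * Sn_dim (S i)\<close> is necessary (\<open>generated_dsum_le\<close>).  Conversely, a
  proper submodule is killed by a nonzero homomorphism to some \<open>S i\<close> (\<open>complement_functional\<close>), and
  this homomorphism is a linear relation with coefficients in the field (\<open>dsum_functional_eq\<close>); so
  \<open>r\<close> elements whose \<open>l i\<close> vectors are linearly independent for every \<open>i\<close> generate
  (\<open>generated_dsum\<close>).

  The converse depends on the endomorphisms of a simple module being scalars, although the field need
  not be algebraically closed.  This fails for general finite groups, but it holds for symmetric
  groups (\<open>simple_endomorphism_scalar\<close>). A simple module has a Young subgroup with a nonzero fixed
  vector such that moving a letter of the corresponding word to a smaller value leaves no nonzero
  fixed vector. The symmetrization along such a move then vanishes, and these relations suffice to
  show that symmetrizing over the Young subgroup maps the whole module to a line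
  (\<open>stabilizer_sum_in_line\<close>). So the fixed vectors form a line, on which every endomorphism acts by
  a scalar, and by simplicity it is that scalar everywhere. The assumption on the characteristic
  enters here: the numbers by which one divides are at most \<open>n\<close> or divide \<open>n!\<close>.

  Finally, every submodule \<open>W\<close> of the given direct sum has a complement consisting of some of
  the given copies (\<open>exists_complement\<close>), and \<open>W\<close> is isomorphic to the sum of the remaining copies.  As
  long as a multiplicity in \<open>W\<close> is smaller than both bounds, a copy can be moved from the
  complement to \<open>W\<close> without destroying generation by \<open>r\<close> elements (\<open>complement_shrink\<close>), so \<open>W\<close> is
  not maximal.  Taking as many of the given copies as the bounds allow gives a maximal submodule.
\<close>

text \<open>
  The group consists of the permutations of \<open>{1..n}\<close>; rewriting this interval to \<open>{Suc 0..n}\<close> would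
  keep facts about it from being applied.
\<close>

declare One_nat_def [simp del]

section \<open>Modules and homomorphisms\<close>

context Sn_module
begin

lemmas zero_mem = subspace_0[OF subspace_underlying]
lemmas add_mem = subspace_add[OF subspace_underlying]
lemmas scale_mem = subspace_scale[OF subspace_underlying]
lemmas sum_mem = subspace_sum[OF subspace_underlying]
lemmas diff_mem = subspace_diff[OF subspace_underlying]

lemma act_zero: "p permutes {1..n} \<Longrightarrow> act M p 0 = 0"
  using act_add[of p 0 0] zero_mem by simp

lemma act_sum:
  assumes "p permutes {1..n}" "\<And>a. a \<in> A \<Longrightarrow> g a \<in> underlying M"
  shows "act M p (\<Sum>a\<in>A. g a) = (\<Sum>a\<in>A. act M p (g a))"
  using assms
  by (induction A rule: infinite_finite_induct) (simp_all add: act_zero act_add sum_mem)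

lemma submodule_orbit_span:
  assumes v: "v \<in> underlying M"
  shows "Sn_submodule n M (span ((\<lambda>p. act M p v) ` {p. p permutes {1..n}}))"
proof -
  define B where "B = (\<lambda>p. act M p v) ` {p. p permutes {1..n}}"
  have sp: "span B \<subseteq> underlying M"
    by (rule span_minimal[OF _ subspace_underlying]) (auto simp: B_def act_closed v)
  have "span B \<subseteq> {w \<in> underlying M. act M p w \<in> span B}" if p: "p permutes {1..n}" for p
  proof (rule span_minimal)
    have "act M p (act M q v) \<in> B" if q: "q permutes {1..n}" for q
    proof -
      have "act M p (act M q v) = act M (p \<circ> q) v" using p q v by (simp add: act_comp)
      then show ?thesis using permutes_compose[OF q p] by (auto simp: B_def)
    qed
    then show "B \<subseteq> {w \<in> underlying M. act M p w \<in> span B}"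
      using v by (auto simp: B_def act_closed intro!: span_base)
    show "subspace {w \<in> underlying M. act M p w \<in> span B}"
      unfolding subspace_def
      by (auto simp: p zero_mem add_mem scale_mem act_zero act_add act_scal span_zero span_add span_scale)
  qed
  then show ?thesis using sp unfolding Sn_submodule_def B_def by (auto simp: subset_iff)
qed

lemma simple_eq_orbit_span:
  assumes "Sn_simple n M" "v \<in> underlying M" "v \<noteq> 0"
  shows "underlying M = span ((\<lambda>p. act M p v) ` {p. p permutes {1..n}})"
proof -
  have "v \<in> span ((\<lambda>p. act M p v) ` {p. p permutes {1..n}})"
    using assms(2) by (auto simp: act_id permutes_id intro!: span_base image_eqI[where x = id])
  then show ?thesis
    using submodule_orbit_span[OF assms(2)] assms by (auto simp: Sn_simple_def)
qed

end

definition Sn_hom :: "nat \<Rightarrow> ('k::field, 'v::ab_group_add) perm_module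
    \<Rightarrow> ('k, 'w::ab_group_add) perm_module \<Rightarrow> ('v \<Rightarrow> 'w) \<Rightarrow> bool" where
  "Sn_hom n M N h \<longleftrightarrow> (\<forall>u\<in>underlying M. h u \<in> underlying N) \<and>
     (\<forall>u\<in>underlying M. \<forall>v\<in>underlying M. h (u + v) = h u + h v) \<and>
     (\<forall>c. \<forall>v\<in>underlying M. h (scal M c v) = scal N c (h v)) \<and>
     (\<forall>p. p permutes {1..n} \<longrightarrow> (\<forall>v\<in>underlying M. h (act M p v) = act N p (h v)))"

lemma Sn_hom_zero:
  assumes "Sn_module n M" "Sn_hom n M N h"
  shows "h 0 = 0"
proof -
  interpret Sn_module n M by fact
  have "h (0 + 0) = h 0 + h 0" using assms(2) zero_mem unfolding Sn_hom_def by blast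
  then show ?thesis by simp
qed

lemma Sn_hom_sum:
  assumes "Sn_module n M" "Sn_hom n M N h" "\<And>a. a \<in> A \<Longrightarrow> f a \<in> underlying M"
  shows "h (\<Sum>a\<in>A. f a) = (\<Sum>a\<in>A. h (f a))"
proof -
  interpret Sn_module n M by fact
  show ?thesis
    using assms(3)
  proof (induction A rule: infinite_finite_induct)
    case (insert a A)
    have "h (f a + sum f A) = h (f a) + h (sum f A)"
      using assms(2) insert.prems unfolding Sn_hom_def by (simp add: sum_mem)
    then show ?case using insert by simp
  qed (simp_all add: Sn_hom_zero[OF assms(1,2)])
qed

lemma Sn_hom_comp:
  assumes "Sn_hom n M N g" "Sn_hom n N P h"
  shows "Sn_hom n M P (\<lambda>u. h (g u))"
  using assms unfolding Sn_hom_def by simp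

lemma Sn_hom_vimage:
  assumes M: "Sn_module n M" and N: "Sn_module n N" and h: "Sn_hom n M N h" and Y: "Sn_submodule n N Y"
  shows "Sn_submodule n M {u \<in> underlying M. h u \<in> Y}"
proof -
  interpret M: Sn_module n M by fact
  interpret N: Sn_module n N by fact
  have "N.subspace Y" "\<And>p w. p permutes {1..n} \<Longrightarrow> w \<in> Y \<Longrightarrow> act N p w \<in> Y"
    using Y by (auto simp: Sn_submodule_def)
  then show ?thesis
    using h Sn_hom_zero[OF M h]
    unfolding Sn_submodule_def M.subspace_def N.subspace_def
    by (auto simp: Sn_hom_def M.zero_mem M.add_mem M.scale_mem M.act_closed)
qed

lemma Sn_hom_image:
  assumes M: "Sn_module n M" and N: "Sn_module n N" and h: "Sn_hom n M N h" and X: "Sn_submodule n M X"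
  shows "Sn_submodule n N (h ` X)"
proof -
  interpret M: Sn_module n M by fact
  interpret N: Sn_module n N by fact
  have XU: "X \<subseteq> underlying M" and ss: "M.subspace X"
    and actX: "\<And>p w. p permutes {1..n} \<Longrightarrow> w \<in> X \<Longrightarrow> act M p w \<in> X"
    using X by (auto simp: Sn_submodule_def)
  have add: "h u + h v = h (u + v)" and sc: "scal N c (h u) = h (scal M c u)"
    if "u \<in> X" "v \<in> X" for u v c
    using h XU that unfolding Sn_hom_def by (auto simp: subset_iff)
  have ac: "act N p (h u) = h (act M p u)" if "p permutes {1..n}" "u \<in> X" for p u
    using h XU that unfolding Sn_hom_def by (auto simp: subset_iff)
  have "N.subspace (h ` X)"
    unfolding N.subspace_def
    using ss Sn_hom_zero[OF M h] by (auto simp: M.subspace_def add sc intro: rev_image_eqI)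
  moreover have "h ` X \<subseteq> underlying N" using h XU by (auto simp: Sn_hom_def)
  ultimately show ?thesis using ac actX by (auto simp: Sn_submodule_def)
qed

lemma Sn_submodule_zero: "Sn_module n M \<Longrightarrow> Sn_submodule n M {0}"
proof -
  assume "Sn_module n M"
  then interpret Sn_module n M .
  show ?thesis by (auto simp: Sn_submodule_def zero_mem subspace_single_0 act_zero)
qed

lemma Sn_submodule_underlying: "Sn_module n M \<Longrightarrow> Sn_submodule n M (underlying M)"
proof -
  assume "Sn_module n M"
  then interpret Sn_module n M .
  show ?thesis by (auto simp: Sn_submodule_def subspace_underlying act_closed)
qed

text \<open>Schur's lemma: the kernel and the image of \<open>h\<close> are submodules, and \<open>h\<close> is not zero.\<close>

lemma simple_hom_iso:
  assumes M: "Sn_simple n M" and N: "Sn_simple n N" and h: "Sn_hom n M N h"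
    and v: "v \<in> underlying M" "h v \<noteq> 0"
  shows "Sn_iso n M N"
proof -
  have mod: "Sn_module n M" "Sn_module n N" using M N by (auto simp: Sn_simple_def)
  interpret M: Sn_module n M by (rule mod)
  let ?K = "{u \<in> underlying M. h u \<in> {0}}"
  have "Sn_submodule n M ?K"
    by (rule Sn_hom_vimage[OF mod h Sn_submodule_zero[OF mod(2)]])
  moreover have "?K \<noteq> underlying M" using v by blast
  ultimately have K: "?K = {0}" using M unfolding Sn_simple_def by blast
  have "Sn_submodule n N (h ` underlying M)"
    by (rule Sn_hom_image[OF mod h Sn_submodule_underlying[OF mod(1)]])
  moreover have "h ` underlying M \<noteq> {0}" using v by blast
  ultimately have "h ` underlying M = underlying N" using N unfolding Sn_simple_def by blast
  moreover have "inj_on h (underlying M)"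
  proof
    fix x y assume xy: "x \<in> underlying M" "y \<in> underlying M" "h x = h y"
    have "h (y + (x - y)) = h y + h (x - y)"
      using h xy M.diff_mem unfolding Sn_hom_def by blast
    then have "x - y \<in> ?K" using xy by (simp add: M.diff_mem)
    then have "x - y = 0" unfolding K by blast
    then show "x = y" by simp
  qed
  ultimately show ?thesis
    using h unfolding Sn_iso_def Sn_hom_def bij_betw_def by blast
qed

lemma Sn_isoE:
  assumes M: "Sn_module n M" and "Sn_iso n M N"
  obtains h g where "Sn_hom n M N h" "Sn_hom n N M g"
    "\<And>u. u \<in> underlying M \<Longrightarrow> g (h u) = u" "\<And>v. v \<in> underlying N \<Longrightarrow> h (g v) = v"
proof -
  interpret M: Sn_module n M by fact
  obtain h where bij: "bij_betw h (underlying M) (underlying N)" and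
    add: "\<And>u v. \<lbrakk>u \<in> underlying M; v \<in> underlying M\<rbrakk> \<Longrightarrow> h (u + v) = h u + h v" and
    sc: "\<And>c v. v \<in> underlying M \<Longrightarrow> h (scal M c v) = scal N c (h v)" and
    ac: "\<And>p v. \<lbrakk>p permutes {1..n}; v \<in> underlying M\<rbrakk> \<Longrightarrow> h (act M p v) = act N p (h v)"
    using assms(2) unfolding Sn_iso_def by blast
  define g where "g = inv_into (underlying M) h"
  have hU: "h u \<in> underlying N" if "u \<in> underlying M" for u using bij that by (auto simp: bij_betw_def)
  have gU: "g v \<in> underlying M" and hg: "h (g v) = v" if "v \<in> underlying N" for v
    using bij that by (auto simp: g_def bij_betw_def inv_into_into f_inv_into_f)
  have gh: "g (h u) = u" if "u \<in> underlying M" for u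
    using bij that by (auto simp: g_def bij_betw_def)
  have "Sn_hom n M N h" using hU add sc ac by (simp add: Sn_hom_def)
  moreover have "Sn_hom n N M g"
    unfolding Sn_hom_def
  proof (intro conjI ballI allI impI)
    fix u v assume uv: "u \<in> underlying N" "v \<in> underlying N"
    have "g (h (g u + g v)) = g u + g v" using uv by (intro gh M.add_mem gU)
    then show "g (u + v) = g u + g v" using uv by (simp add: add gU hg)
  next
    fix c v assume v: "v \<in> underlying N"
    have "g (h (scal M c (g v))) = scal M c (g v)" using v by (intro gh M.scale_mem gU)
    then show "g (scal N c v) = scal M c (g v)" using v by (simp add: sc gU hg)
  next
    fix p v assume v: "v \<in> underlying N" and p: "p permutes {1..n}"
    have "g (h (act M p (g v))) = act M p (g v)" using v p by (intro gh M.act_closed gU)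
    then show "g (act N p v) = act M p (g v)" using v p by (simp add: ac gU hg)
  qed (rule gU)
  ultimately show thesis using gh hg that by blast
qed

lemma Sn_isoI:
  assumes "Sn_hom n M N h" "Sn_hom n N M g"
    "\<And>u. u \<in> underlying M \<Longrightarrow> g (h u) = u" "\<And>v. v \<in> underlying N \<Longrightarrow> h (g v) = v"
  shows "Sn_iso n M N"
proof -
  have "bij_betw h (underlying M) (underlying N)"
    by (rule bij_betw_byWitness[where f' = g]) (use assms in \<open>auto simp: Sn_hom_def\<close>)
  then show ?thesis using assms(1) unfolding Sn_iso_def Sn_hom_def by blast
qed

lemma Sn_iso_sym: "\<lbrakk>Sn_module n M; Sn_iso n M N\<rbrakk> \<Longrightarrow> Sn_iso n N M"
  by (rule Sn_isoE[of n M N]) (auto intro: Sn_isoI)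

text \<open>
  This form is used throughout: to show that elements generate, one shows that no proper submodule
  contains them.
\<close>

lemma Sn_generated_iff:
  assumes "Sn_module n M"
  shows "Sn_generated n r M \<longleftrightarrow> (\<exists>f :: nat \<Rightarrow> _. (\<forall>t\<in>{1..r}. f t \<in> underlying M) \<and>
    (\<forall>X. Sn_submodule n M X \<longrightarrow> (\<forall>t\<in>{1..r}. f t \<in> X) \<longrightarrow> X = underlying M))"
proof -
  have "Sn_submodule n M hull f ` {1..r} = underlying M \<longleftrightarrow>
      (\<forall>X. Sn_submodule n M X \<longrightarrow> (\<forall>t\<in>{1..r}. f t \<in> X) \<longrightarrow> X = underlying M)"
    if "\<forall>t\<in>{1..r}. f t \<in> underlying M" for f
  proof (intro iffI allI impI)
    fix X assume *: "Sn_submodule n M hull f ` {1..r} = underlying M"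
      and X: "Sn_submodule n M X" "\<forall>t\<in>{1..r}. f t \<in> X"
    have "Sn_submodule n M hull f ` {1..r} \<subseteq> X"
      by (rule hull_minimal) (use X in auto)
    then show "X = underlying M" using * X(1) by (auto simp: Sn_submodule_def)
  next
    assume *: "\<forall>X. Sn_submodule n M X \<longrightarrow> (\<forall>t\<in>{1..r}. f t \<in> X) \<longrightarrow> X = underlying M"
    show "Sn_submodule n M hull f ` {1..r} = underlying M"
    proof (rule hull_unique)
      show "f ` {1..r} \<subseteq> underlying M" using that by blast
      show "Sn_submodule n M (underlying M)" by (rule Sn_submodule_underlying[OF assms])
      fix X assume "f ` {1..r} \<subseteq> X" "Sn_submodule n M X"
      then have "X = underlying M" using * by blast
      then show "underlying M \<subseteq> X" by simp
    qed
  qed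
  then show ?thesis unfolding Sn_generated_def by blast
qed

lemma Sn_generated_iso:
  assumes M: "Sn_module n M" and N: "Sn_module n N" and iso: "Sn_iso n M N"
    and gen: "Sn_generated n r M"
  shows "Sn_generated n r N"
proof -
  obtain h g where h: "Sn_hom n M N h" and g: "Sn_hom n N M g"
    and gh: "\<And>u. u \<in> underlying M \<Longrightarrow> g (h u) = u" and hg: "\<And>v. v \<in> underlying N \<Longrightarrow> h (g v) = v"
    using Sn_isoE[OF M iso] by metis
  obtain f where f: "\<forall>t\<in>{1..r}. f t \<in> underlying M"
    "\<And>X. \<lbrakk>Sn_submodule n M X; \<forall>t\<in>{1..r}. f t \<in> X\<rbrakk> \<Longrightarrow> X = underlying M"
    using gen unfolding Sn_generated_iff[OF M] by blast
  have "Y = underlying N" if Y: "Sn_submodule n N Y" "\<forall>t\<in>{1..r}. h (f t) \<in> Y" for Y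
  proof
    show "Y \<subseteq> underlying N" using Y by (simp add: Sn_submodule_def)
    have "{u \<in> underlying M. h u \<in> Y} = underlying M"
      using Y f by (intro f(2) Sn_hom_vimage[OF M N h]) auto
    then have "h (g v) \<in> Y" if "v \<in> underlying N" for v
      using g that by (auto simp: Sn_hom_def)
    then show "underlying N \<subseteq> Y" using hg by auto
  qed
  then show ?thesis
    unfolding Sn_generated_iff[OF N] using f(1) h
    by (intro exI[of _ "\<lambda>t. h (f t)"]) (auto simp: Sn_hom_def)
qed

section \<open>Endomorphisms of simple modules are scalars\<close>

text \<open>
  A word \<open>w\<close> puts the letter \<open>w x\<close> at the position \<open>x\<close>.  Its stabilizer is the Young subgroup of the
  partition of the positions into the classes of equal letters.
\<close>

definition word_stabilizer :: "nat \<Rightarrow> (nat \<Rightarrow> nat) \<Rightarrow> (nat \<Rightarrow> nat) set" where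
  "word_stabilizer n w = {p. p permutes {1..n} \<and> w \<circ> p = w}"

lemma finite_word_stabilizer [simp]: "finite (word_stabilizer n w)"
  by (rule finite_subset[OF _ finite_permutations[of "{1..n}"]]) (auto simp: word_stabilizer_def)

text \<open>The fibres of \<open>p \<mapsto> w \<circ> p\<close> on the symmetric group are the cosets of the stabilizer.\<close>

lemma card_word_stabilizer_dvd: "card (word_stabilizer n w) dvd fact n"
proof -
  let ?G = "{p. p permutes {1..n}}"
  have fin: "finite ?G" by (simp add: finite_permutations)
  have fibre: "card {p \<in> ?G. w \<circ> p = y} = card (word_stabilizer n w)" if "y \<in> (\<circ>) w ` ?G" for y
  proof -
    obtain q where q: "q permutes {1..n}" "y = w \<circ> q" using \<open>y \<in> _\<close> by blast
    have "bij_betw (\<lambda>p. p \<circ> q) (word_stabilizer n w) {p \<in> ?G. w \<circ> p = y}"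
    proof (rule bij_betw_byWitness[where f' = "\<lambda>p. p \<circ> inv q"])
      show "(\<lambda>p. p \<circ> q) ` word_stabilizer n w \<subseteq> {p \<in> ?G. w \<circ> p = y}"
        using q by (auto simp: word_stabilizer_def permutes_compose o_assoc)
      show "(\<lambda>p. p \<circ> inv q) ` {p \<in> ?G. w \<circ> p = y} \<subseteq> word_stabilizer n w"
        using q by (auto simp: word_stabilizer_def permutes_compose permutes_inv o_assoc)
          (metis comp_assoc comp_id permutes_inv_o(1))
    qed (use q in \<open>auto simp: comp_assoc permutes_inv_o\<close>)
    then show ?thesis by (simp add: bij_betw_same_card)
  qed
  have "fact n = card ?G" by (simp add: card_permutations[of _ n])
  also have "\<dots> = (\<Sum>y\<in>(\<circ>) w ` ?G. card {p \<in> ?G. w \<circ> p = y})"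
    unfolding card_eq_sum by (rule sum.image_gen[OF fin])
  also have "\<dots> = card ((\<circ>) w ` ?G) * card (word_stabilizer n w)" using fibre by simp
  finally show ?thesis by simp
qed

lemma of_nat_neq_0_if_le:
  assumes "CHAR('k::field) = 0 \<or> CHAR('k) > n" "0 < c" "c \<le> n"
  shows "(of_nat c :: 'k) \<noteq> 0"
  using assms dvd_imp_le[of "CHAR('k)" c] by (auto simp: of_nat_eq_0_iff_char_dvd)

lemma of_nat_neq_0_if_dvd_fact:
  assumes "CHAR('k::field) = 0 \<or> CHAR('k) > n" "c dvd fact n"
  shows "(of_nat c :: 'k) \<noteq> 0"
proof
  assume "(of_nat c :: 'k) = 0"
  then have "(of_nat (fact n) :: 'k) = 0" using assms(2) by (metis dvdE mult_zero_left of_nat_mult)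
  moreover have "(of_nat (fact j) :: 'k) \<noteq> 0" if "j \<le> n" for j
    using that
  proof (induction j)
    case (Suc j)
    then show ?case
      using of_nat_neq_0_if_le[OF assms(1), of "Suc j"]
      by (simp only: fact_Suc of_nat_mult of_nat_id mult_eq_0_iff) simp
  qed simp
  ultimately show False by simp
qed

context Sn_module
begin

definition word_invariants :: "(nat \<Rightarrow> nat) \<Rightarrow> 'v set" where
  "word_invariants w = {v \<in> underlying M. \<forall>p\<in>word_stabilizer n w. act M p v = v}"

text \<open>
  Let \<open>Y\<close> be the positions of the letter \<open>i\<close> in the new word \<open>w(x := i)\<close>.  The permutations
  \<open>transpose x y\<close> with \<open>y \<in> Y\<close>, where \<open>y = x\<close> gives the identity, represent the cosets in the
  stabilizer of the new word of those elements that also stabilize \<open>w\<close>.  So the sum symmetrizes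
  \<open>v\<close> over the stabilizer of the new word.
\<close>

lemma move_letter_invariant:
  assumes v: "v \<in> word_invariants w" and x: "x \<in> {1..n}" "i \<noteq> w x"
  shows "v + (\<Sum>y | y \<in> {1..n} \<and> w y = i. act M (transpose x y) v) \<in> word_invariants (w(x := i))"
proof -
  define Y where "Y = insert x {y \<in> {1..n}. w y = i}"
  have fin: "finite Y" by (simp add: Y_def)
  have Yn: "Y \<subseteq> {1..n}" using x by (auto simp: Y_def)
  have vU: "v \<in> underlying M" using v by (simp add: word_invariants_def)
  have tr: "transpose x y permutes {1..n}" if "y \<in> Y" for y
    using x(1) subsetD[OF Yn that] by (rule permutes_swap_id)
  have eq: "v + (\<Sum>y | y \<in> {1..n} \<and> w y = i. act M (transpose x y) v) = (\<Sum>y\<in>Y. act M (transpose x y) v)"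
    using x vU by (simp add: Y_def act_id)
  have "act M g (\<Sum>y\<in>Y. act M (transpose x y) v) = (\<Sum>y\<in>Y. act M (transpose x y) v)"
    if "g \<in> word_stabilizer n (w(x := i))" for g
  proof -
    have g: "g permutes {1..n}" and gw: "\<And>z. (w(x := i)) (g z) = (w(x := i)) z"
      using that by (auto simp: word_stabilizer_def fun_eq_iff)
    have Y': "z \<in> Y \<longleftrightarrow> z \<in> {1..n} \<and> (w(x := i)) z = i" for z
      using x by (auto simp: Y_def)
    have gY: "g z \<in> Y \<longleftrightarrow> z \<in> Y" for z
      unfolding Y' gw using permutes_in_image[OF g] by blast
    have bij: "bij_betw g Y Y"
      using permutes_inj_on[OF g] gY by (intro bij_betw_imageI endo_inj_surj fin) auto
    have step: "act M g (act M (transpose x y) v) = act M (transpose x (g y)) v" if y: "y \<in> Y" for y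
    proof -
      \<comment> \<open>\<open>g\<close> permutes the cosets: it takes that of \<open>transpose x y\<close> to that of \<open>transpose x (g y)\<close>,
        up to an element \<open>h\<close> that fixes \<open>v\<close>.\<close>
      define h where "h = transpose x (g y) \<circ> g \<circ> transpose x y"
      have hp: "h permutes {1..n}"
        unfolding h_def using tr[OF y] g tr[of "g y"] y gY by (simp add: permutes_compose)
      have "w (h z) = w z" for z
      proof -
        consider "z = x" | "z = y" "z \<noteq> x" | "z \<noteq> x" "z \<noteq> y" by blast
        then show ?thesis
        proof cases
          case 1
          then show ?thesis by (simp add: h_def)
        next
          case 2
          then have "w z = i" using y by (auto simp: Y_def)
          moreover have "g x \<noteq> g y" using 2 permutes_inj[OF g] by (auto simp: inj_def)
          moreover have "x \<in> Y" by (simp add: Y_def)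
          ultimately have "transpose x (g y) (g x) \<in> Y - {x}" "w z = i"
            using gY[of x] gY[of y] y by (auto simp: transpose_def)
          then show ?thesis using 2 by (auto simp: h_def Y_def)
        next
          case 3
          have ne: "g z \<noteq> g y" using 3 permutes_inj[OF g] by (auto simp: inj_def)
          show ?thesis
          proof (cases "z \<in> Y")
            case True
            then have "transpose x (g y) (g z) \<in> Y - {x}"
              using gY[of z] gY[of y] y ne by (auto simp: transpose_def)
            then show ?thesis using 3 True by (auto simp: h_def Y_def)
          next
            case False
            then have "g z \<notin> Y" using gY by blast
            then have "g z \<noteq> x" by (auto simp: Y_def)
            then show ?thesis using 3 ne gw[of z] by (simp add: h_def)
          qed
        qed
      qed
      then have "h \<in> word_stabilizer n w" using hp by (auto simp: word_stabilizer_def)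
      then have hv: "act M h v = v" using v by (simp add: word_invariants_def)
      have "g \<circ> transpose x y = transpose x (g y) \<circ> h"
        by (simp add: h_def comp_assoc[symmetric])
      then have "act M g (act M (transpose x y) v) = act M (transpose x (g y)) (act M h v)"
        using g hp tr[OF y] tr[of "g y"] y gY vU by (metis act_comp)
      then show ?thesis by (simp add: hv)
    qed
    have "act M g (\<Sum>y\<in>Y. act M (transpose x y) v) = (\<Sum>y\<in>Y. act M (transpose x (g y)) v)"
      using g tr vU by (subst act_sum) (simp_all add: act_closed step)
    also have "\<dots> = (\<Sum>y\<in>Y. act M (transpose x y) v)"
      by (rule sum.reindex_bij_betw[OF bij])
    finally show ?thesis .
  qed
  moreover have "(\<Sum>y\<in>Y. act M (transpose x y) v) \<in> underlying M"
    using tr vU by (intro sum_mem) (simp add: act_closed)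
  ultimately show ?thesis unfolding eq by (simp add: word_invariants_def)
qed

text \<open>
  Write \<open>u = w \<circ> inv g\<close>.  If \<open>u = w\<close>, then \<open>g\<close> stabilizes \<open>w\<close> and the sum is a multiple of \<open>v\<close>.
  Otherwise let \<open>i\<close> be the least letter of \<open>w\<close> at a position where the words differ, and \<open>x\<close> such
  a position.  Comparing letter classes shows \<open>u x > i\<close>, so the relation \<open>rel\<close>, translated by \<open>g\<close>, expresses
  \<open>g v\<close> by the vectors \<open>transpose x y \<circ> g\<close> applied to \<open>v\<close> with \<open>u y = i\<close>.  If also \<open>w y = i\<close>, then
  \<open>transpose x y\<close> is absorbed by the symmetrization; collecting these terms gives a coefficient
  between \<open>1\<close> and \<open>n\<close>, which is invertible.  For the other \<open>y\<close> the exchange brings \<open>u\<close> closer to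
  \<open>w\<close>: the sum of the products \<open>w x * u x\<close>, which cannot exceed the square of the letter sum,
  increases.
\<close>

lemma stabilizer_sum_in_line:
  assumes char: "CHAR('k) = 0 \<or> CHAR('k) > n"
    and v: "v \<in> word_invariants w"
    and rel: "\<And>x i. \<lbrakk>x \<in> {1..n}; i < w x\<rbrakk>
      \<Longrightarrow> v + (\<Sum>y | y \<in> {1..n} \<and> w y = i. act M (transpose x y) v) = 0"
    and g: "g permutes {1..n}"
  shows "\<exists>c. (\<Sum>p\<in>word_stabilizer n w. act M p (act M g v)) = scal M c v"
  using g
proof (induction "(\<Sum>x\<in>{1..n}. w x) ^ 2 - (\<Sum>x\<in>{1..n}. w x * w (inv g x))"
    arbitrary: g rule: less_induct)
  case less
  note g = \<open>g permutes {1..n}\<close>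
  have gi: "inv g permutes {1..n}" using g by (rule permutes_inv)
  define u where "u = w \<circ> inv g"
  define a where "a h = (\<Sum>p\<in>word_stabilizer n w. act M p (act M h v))" for h
  have vU: "v \<in> underlying M" using v by (simp add: word_invariants_def)
  have stab: "p permutes {1..n}" if "p \<in> word_stabilizer n w" for p
    using that by (simp add: word_stabilizer_def)
  show ?case
  proof (cases "\<forall>x\<in>{1..n}. u x = w x")
    case True
    have "u x = w x" for x
      using True permutes_not_in[OF gi, of x] by (cases "x \<in> {1..n}") (auto simp: u_def)
    then have "u \<circ> g = w \<circ> g" by auto
    then have "w \<circ> g = w" using permutes_inv_o(2)[OF g] by (simp add: u_def comp_assoc)
    then have "act M g v = v" using v g by (auto simp: word_invariants_def word_stabilizer_def)
    moreover have "act M p v = v" if "p \<in> word_stabilizer n w" for p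
      using v that by (simp add: word_invariants_def)
    ultimately have "a g = scal M (of_nat (card (word_stabilizer n w))) v"
      by (simp add: a_def sum_constant_scale)
    then show ?thesis unfolding a_def by blast
  next
    case False
    then obtain x where x: "x \<in> {1..n}" "u x \<noteq> w x"
      and min: "\<And>y. y \<in> {1..n} \<Longrightarrow> u y \<noteq> w y \<Longrightarrow> w x \<le> w y"
      using ex_has_least_nat[of "\<lambda>x. x \<in> {1..n} \<and> u x \<noteq> w x" _ w] by blast
    define i where "i = w x"
    have low: "i \<le> w y" if "y \<in> {1..n}" "u y = i \<or> w y = i" for y
      using min that unfolding i_def by (cases "u y = w y") auto
    have "i < u x"
    proof (rule ccontr)
      assume "\<not> i < u x"
      then have lt: "u x < i" using x by (simp add: i_def)
      define l where "l = u x"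
      \<comment> \<open>Below \<open>i\<close> the words agree wherever \<open>w\<close> has the letter, and the classes have equal size.\<close>
      let ?A = "{y \<in> {1..n}. w y = l}" and ?B = "{y \<in> {1..n}. u y = l}"
      have "?A \<subseteq> ?B" using min lt by (force simp: l_def i_def)
      moreover have "bij_betw (inv g) ?B ?A"
        unfolding u_def
        by (rule bij_betw_byWitness[where f' = g])
          (auto simp: permutes_inverses[OF g] permutes_in_image[OF g] permutes_in_image[OF gi]
            simp del: atLeastAtMost_iff)
      ultimately have "?A = ?B" by (intro card_subset_eq) (auto dest: bij_betw_same_card)
      moreover have "x \<in> ?B" using x by (simp add: l_def)
      ultimately have "w x = l" by blast
      then show False using lt by (simp add: l_def i_def)
    qed
    have tr: "transpose x y permutes {1..n}" if "y \<in> {1..n}" for y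
      using x that by (simp add: permutes_swap_id)
    have rel': "act M g v + (\<Sum>y | y \<in> {1..n} \<and> u y = i. act M (transpose x y \<circ> g) v) = 0"
    proof -
      let ?x = "inv g x"
      have x': "?x \<in> {1..n}" "i < w ?x"
        using x permutes_in_image[OF gi] \<open>i < u x\<close> by (auto simp: u_def simp del: atLeastAtMost_iff)
      have cl': "act M (transpose ?x y) v \<in> underlying M" if "y \<in> {y. y \<in> {1..n} \<and> w y = i}" for y
        using that x' vU by (intro act_closed permutes_swap_id) auto
      have "act M g 0 = act M g v + (\<Sum>y | y \<in> {1..n} \<and> w y = i. act M g (act M (transpose ?x y) v))"
        unfolding rel[OF x', symmetric]
        by (simp only: act_add[OF g vU sum_mem[OF cl']] act_sum[OF g cl'])
      also have "(\<Sum>y | y \<in> {1..n} \<and> w y = i. act M g (act M (transpose ?x y) v))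
          = (\<Sum>y | y \<in> {1..n} \<and> u y = i. act M (transpose x y \<circ> g) v)"
      proof (rule sum.reindex_bij_witness[where i = "inv g" and j = g])
        fix y assume y: "y \<in> {y. y \<in> {1..n} \<and> w y = i}"
        have "transpose x (g y) \<circ> g = g \<circ> transpose ?x y"
          using transpose_comp_eq[OF permutes_bij[OF g], of x "g y"] by (simp add: permutes_inverses[OF g])
        then show "act M (transpose x (g y) \<circ> g) v = act M g (act M (transpose ?x y) v)"
          using y x' g vU by (simp add: act_comp permutes_swap_id)
      qed (auto simp: u_def permutes_inverses[OF g] permutes_in_image[OF g] permutes_in_image[OF gi]
            simp del: atLeastAtMost_iff)
      finally show ?thesis using act_zero[OF g] by simp
    qed
    \<comment> \<open>\<open>P\<close> holds the positions whose transposition is absorbed, \<open>Q\<close> those that make progress.\<close>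
    define P where "P = {y \<in> {1..n}. u y = i \<and> w y = i}"
    define Q where "Q = {y \<in> {1..n}. u y = i \<and> w y \<noteq> i}"
    have PQ: "{y. y \<in> {1..n} \<and> u y = i} = P \<union> Q" "P \<inter> Q = {}" "finite P" "finite Q"
      by (auto simp: P_def Q_def)
    have cl: "act M h v \<in> underlying M" if "h permutes {1..n}" for h using vU that by (rule act_closed[rotated])
    have trg: "transpose x y \<circ> g permutes {1..n}" if "y \<in> {1..n}" for y
      using permutes_compose[OF g tr[OF that]] .
    have "0 = (\<Sum>p\<in>word_stabilizer n w. act M p (act M g v + (\<Sum>y\<in>P \<union> Q. act M (transpose x y \<circ> g) v)))"
      using rel' PQ(1) stab by (simp add: act_zero)
    also have "\<dots> = a g + (\<Sum>y\<in>P \<union> Q. a (transpose x y \<circ> g))"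
    proof -
      have clPQ: "act M (transpose x y \<circ> g) v \<in> underlying M" if "y \<in> P \<union> Q" for y
        using that by (intro cl trg) (auto simp: P_def Q_def)
      have "act M p (act M g v + (\<Sum>y\<in>P \<union> Q. act M (transpose x y \<circ> g) v))
          = act M p (act M g v) + (\<Sum>y\<in>P \<union> Q. act M p (act M (transpose x y \<circ> g) v))"
        if "p \<in> word_stabilizer n w" for p
        by (simp only: act_add[OF stab[OF that] cl[OF g] sum_mem[OF clPQ]] act_sum[OF stab[OF that] clPQ])
      then show ?thesis
        unfolding a_def by (simp add: sum.distrib) (rule sum.swap)
    qed
    also have "\<dots> = a g + ((\<Sum>y\<in>P. a (transpose x y \<circ> g)) + (\<Sum>y\<in>Q. a (transpose x y \<circ> g)))"
      using PQ by (simp add: sum.union_disjoint)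
    also have "(\<Sum>y\<in>P. a (transpose x y \<circ> g)) = (\<Sum>y\<in>P. a g)"
    proof (rule sum.cong[OF refl])
      fix y assume y: "y \<in> P"
      let ?t = "transpose x y"
      have yn: "y \<in> {1..n}" and wy: "w y = w x" using y by (auto simp: P_def i_def)
      have wt: "w \<circ> ?t = w" using wy by (auto simp: transpose_def)
      have "a (?t \<circ> g) = (\<Sum>p\<in>word_stabilizer n w. act M (p \<circ> ?t) (act M g v))"
        unfolding a_def by (rule sum.cong) (auto simp: act_comp stab tr[OF yn] g vU cl)
      also have "\<dots> = a g"
        unfolding a_def
        by (rule sum.reindex_bij_witness[where i = "\<lambda>p. p \<circ> ?t" and j = "\<lambda>p. p \<circ> ?t"])
          (auto simp: word_stabilizer_def comp_assoc wt permutes_compose tr[OF yn] o_assoc[of w])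
      finally show "a (?t \<circ> g) = a g" .
    qed
    finally have main: "scal M (of_nat (Suc (card P))) (a g) = - (\<Sum>y\<in>Q. a (transpose x y \<circ> g))"
      by (simp add: sum_constant_scale scale_left_distrib eq_neg_iff_add_eq_0 add.assoc comp_def)
    have "\<exists>c. a (transpose x y \<circ> g) = scal M c v" if y: "y \<in> Q" for y
    proof -
      have yn: "y \<in> {1..n}" and uy: "u y = i" and wy: "w y \<noteq> i" using y by (auto simp: Q_def)
      have xy: "x \<noteq> y" using \<open>i < u x\<close> uy by auto
      have iy: "i < w y" using low[OF yn] uy wy by force
      have inv': "w (inv (transpose x y \<circ> g) z) = u (transpose x y z)" for z
        by (simp add: o_inv_distrib[OF bij_transpose permutes_bij[OF g]] u_def)
      let ?T = "\<Sum>z\<in>{1..n}. w z * u z" and ?T' = "\<Sum>z\<in>{1..n}. w z * u (transpose x y z)"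
      let ?R = "{1..n} - {x} - {y}"
      have split: "(\<Sum>z\<in>{1..n}. f z) = f x + (f y + (\<Sum>z\<in>?R. f z))" for f :: "nat \<Rightarrow> nat"
        using x yn xy by (subst sum.remove[of _ x]) (auto simp: sum.remove[of _ y])
      have R: "(\<Sum>z\<in>?R. w z * u (transpose x y z)) = (\<Sum>z\<in>?R. w z * u z)"
        by (rule sum.cong) auto
      \<comment> \<open>The rearrangement inequality for the two positions that are exchanged.\<close>
      have "w x * u x + w y * u y < w x * u y + w y * u x"
      proof -
        obtain s t where "w y = i + s" "s > 0" "u x = i + t" "t > 0"
          using iy \<open>i < u x\<close> less_imp_add_positive by metis
        then show ?thesis using uy by (simp add: i_def[symmetric] algebra_simps)
      qed
      then have lt: "?T < ?T'" unfolding split[of "\<lambda>z. w z * u z"] split[of "\<lambda>z. w z * u (transpose x y z)"] R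
        by simp
      have bound: "?T' \<le> (\<Sum>z\<in>{1..n}. w z) ^ 2"
      proof -
        have "u z \<le> (\<Sum>z\<in>{1..n}. w z)" if "z \<in> {1..n}" for z
          unfolding u_def using that permutes_in_image[OF gi, of z] by (auto intro: member_le_sum)
        then have "u (transpose x y z) \<le> (\<Sum>z\<in>{1..n}. w z)" if "z \<in> {1..n}" for z
          using that permutes_in_image[OF tr[OF yn], of z] by blast
        then have "?T' \<le> (\<Sum>z\<in>{1..n}. w z * (\<Sum>z\<in>{1..n}. w z))"
          by (intro sum_mono mult_left_mono) auto
        then show ?thesis by (simp add: power2_eq_square sum_distrib_right)
      qed
      show ?thesis
        unfolding a_def
      proof (rule less.hyps[OF _ trg[OF yn]])
        show "(\<Sum>z\<in>{1..n}. w z) ^ 2 - (\<Sum>z\<in>{1..n}. w z * w (inv (transpose x y \<circ> g) z))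
            < (\<Sum>z\<in>{1..n}. w z) ^ 2 - (\<Sum>z\<in>{1..n}. w z * w (inv g z))"
          using lt bound unfolding inv' by (simp add: u_def)
      qed
    qed
    then obtain c where "\<And>y. y \<in> Q \<Longrightarrow> a (transpose x y \<circ> g) = scal M (c y) v" by metis
    then have "- (\<Sum>y\<in>Q. a (transpose x y \<circ> g)) = scal M (- (\<Sum>y\<in>Q. c y)) v"
      by (simp add: scale_sum_left)
    moreover have "(of_nat (Suc (card P)) :: 'k) \<noteq> 0"
    proof (rule of_nat_neq_0_if_le[OF char])
      have "P \<subseteq> {1..n} - {x}" using \<open>u x \<noteq> w x\<close> by (auto simp: P_def i_def)
      then have "card P \<le> card ({1..n} - {x})" by (intro card_mono) auto
      then show "Suc (card P) \<le> n" using x(1) by auto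
    qed simp
    ultimately have "a g = scal M (inverse (of_nat (Suc (card P))) * - (\<Sum>y\<in>Q. c y)) v"
      using main by (metis left_inverse scale_one scale_scale)
    then show ?thesis unfolding a_def by blast
  qed
qed

end

text \<open>
  Among the words whose stabilizer fixes a nonzero vector, one with the least letter sum has the
  relations of \<open>stabilizer_sum_in_line\<close>: their left-hand sides are fixed by the stabilizer of a word
  with a smaller letter sum.  So symmetrization maps the module, which is spanned by the orbit of the
  fixed vector \<open>v\<close>, to the line of \<open>v\<close>.  As \<open>h v\<close> is fixed too, symmetrization only multiplies it by
  the order of the stabilizer; so \<open>h v\<close> lies on that line.
\<close>

theorem simple_endomorphism_scalar:
  fixes M :: "('k::field, 'v::ab_group_add) perm_module"
  assumes char: "CHAR('k) = 0 \<or> CHAR('k) > n"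
    and simple: "Sn_simple n M" and h: "Sn_hom n M M h"
  obtains c where "\<And>v. v \<in> underlying M \<Longrightarrow> h v = scal M c v"
proof -
  interpret Sn_module n M using simple by (simp add: Sn_simple_def)
  have "underlying M \<noteq> {0}" using simple by (simp add: Sn_simple_def)
  then obtain v0 where v0: "v0 \<in> underlying M" "v0 \<noteq> 0" using zero_mem by blast
  \<comment> \<open>Distinct letters have a trivial stabilizer, so some word qualifies.\<close>
  have "word_stabilizer n id \<subseteq> {id}" by (auto simp: word_stabilizer_def)
  then have "v0 \<in> word_invariants id" using v0 by (auto simp: word_invariants_def act_id)
  then obtain w where w: "\<exists>v\<in>word_invariants w. v \<noteq> 0"
    and min: "\<And>w' v. v \<in> word_invariants w' \<Longrightarrow> v \<noteq> 0 \<Longrightarrow> (\<Sum>x\<in>{1..n}. w x) \<le> (\<Sum>x\<in>{1..n}. w' x)"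
    using ex_has_least_nat[of "\<lambda>w. \<exists>v\<in>word_invariants w. v \<noteq> 0" id "\<lambda>w. \<Sum>x\<in>{1..n}. w x"] v0 by blast
  obtain v where v: "v \<in> word_invariants w" "v \<noteq> 0" using w by blast
  have vU: "v \<in> underlying M" using v by (simp add: word_invariants_def)
  have rel: "v + (\<Sum>y | y \<in> {1..n} \<and> w y = i. act M (transpose x y) v) = 0"
    if x: "x \<in> {1..n}" "i < w x" for x i
  proof (rule ccontr)
    assume nz: "\<not> ?thesis"
    have "i \<noteq> w x" using x(2) by simp
    from min[OF move_letter_invariant[OF v(1) x(1) this] nz]
    have "(\<Sum>x\<in>{1..n}. w x) \<le> (\<Sum>z\<in>{1..n}. (w(x := i)) z)" .
    moreover have "(\<Sum>z\<in>{1..n}. (w(x := i)) z) < (\<Sum>x\<in>{1..n}. w x)"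
      by (rule sum_strict_mono_ex1) (use x in \<open>auto intro!: bexI[of _ x]\<close>)
    ultimately show False by simp
  qed
  have hU: "h u \<in> underlying M" if "u \<in> underlying M" for u using h that by (simp add: Sn_hom_def)
  define a where "a u = (\<Sum>p\<in>word_stabilizer n w. act M p u)" for u
  have stab: "p permutes {1..n}" if "p \<in> word_stabilizer n w" for p
    using that by (simp add: word_stabilizer_def)
  let ?L = "{u \<in> underlying M. \<exists>c. a u = scal M c v}"
  have "underlying M \<subseteq> ?L"
    unfolding simple_eq_orbit_span[OF simple vU v(2)]
  proof (rule span_minimal)
    show "(\<lambda>p. act M p v) ` {p. p permutes {1..n}} \<subseteq>
        {u \<in> span ((\<lambda>p. act M p v) ` {p. p permutes {1..n}}). \<exists>c. a u = scal M c v}"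
      unfolding a_def using stabilizer_sum_in_line[OF char v(1) rel] by (auto intro: span_base)
    have "a 0 = scal M 0 v" by (simp add: a_def act_zero stab)
    moreover have "a (x + y) = scal M (c + d) v"
      if "x \<in> underlying M" "y \<in> underlying M" "a x = scal M c v" "a y = scal M d v" for x y c d
      using that by (simp add: a_def act_add stab sum.distrib scale_left_distrib)
    moreover have "a (scal M d x) = scal M (d * c) v" if "x \<in> underlying M" "a x = scal M c v" for x c d
      using that by (simp add: a_def act_scal stab flip: scale_sum_right)
    ultimately show "subspace {u \<in> span ((\<lambda>p. act M p v) ` {p. p permutes {1..n}}). \<exists>c. a u = scal M c v}"
      unfolding subspace_def simple_eq_orbit_span[OF simple vU v(2), symmetric]
      by (auto simp: zero_mem add_mem scale_mem) blast+
  qed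
  then obtain c where c: "a (h v) = scal M c v" using hU[OF vU] by blast
  have "act M p (h v) = h v" if "p \<in> word_stabilizer n w" for p
  proof -
    have "act M p (h v) = h (act M p v)" using h vU stab[OF that] by (simp add: Sn_hom_def)
    also have "act M p v = v" using v(1) that by (simp add: word_invariants_def)
    finally show ?thesis .
  qed
  then have "a (h v) = scal M (of_nat (card (word_stabilizer n w))) (h v)"
    by (simp add: a_def sum_constant_scale)
  then have hv: "h v = scal M (c / of_nat (card (word_stabilizer n w))) v" (is "_ = scal M ?c v")
    using c of_nat_neq_0_if_dvd_fact[OF char card_word_stabilizer_dvd]
    by (metis divide_inverse left_inverse mult.commute scale_one scale_scale)
  \<comment> \<open>An eigenspace is a submodule.\<close>
  define K where "K = {u \<in> underlying M. h u = scal M ?c u}"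
  have h0: "h 0 = 0" using h zero_mem unfolding Sn_hom_def by (metis add_cancel_right_right)
  have "Sn_submodule n M K"
    unfolding Sn_submodule_def subspace_def K_def using h h0
    by (auto simp: Sn_hom_def zero_mem add_mem scale_mem act_closed act_scal scale_right_distrib
        scale_left_commute)
  moreover have "v \<in> K" using hv vU by (simp add: K_def)
  ultimately have "K = underlying M" using simple v(2) by (auto simp: Sn_simple_def)
  then show thesis using that unfolding K_def by blast
qed

section \<open>Submodules of a direct sum of simple modules\<close>

definition positions :: "('i \<Rightarrow> nat) \<Rightarrow> ('i \<times> nat) set" where
  "positions m = {(i, j). j < m i}"

definition fibre_card :: "('i \<times> nat) set \<Rightarrow> 'i \<Rightarrow> nat" where
  "fibre_card K i = card {j. (i, j) \<in> K}"

definition single :: "'a \<Rightarrow> 'b \<Rightarrow> 'a \<Rightarrow> 'b::zero" where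
  "single a x = (\<lambda>b. if b = a then x else 0)"

lemma finite_positions: "finite (positions (m :: 'i::finite \<Rightarrow> nat))"
proof -
  have "positions m = (SIGMA i:UNIV. {..<m i})" by (auto simp: positions_def)
  then show ?thesis by simp
qed

lemma finite_fibre: "finite K \<Longrightarrow> finite {j. (i, j) \<in> K}"
  by (rule finite_subset[of _ "snd ` K"]) force+

lemma fibre_card_mono: "\<lbrakk>finite K'; K \<subseteq> K'\<rbrakk> \<Longrightarrow> fibre_card K i \<le> fibre_card K' i"
  unfolding fibre_card_def by (rule card_mono[OF finite_fibre]) auto

lemma fibre_card_positions: "fibre_card (positions m) i = m i"
  by (simp add: fibre_card_def positions_def)

lemma fibre_card_insert:
  assumes "finite K" "(i, j) \<notin> K"
  shows "fibre_card (insert (i, j) K) l = (if l = i then Suc (fibre_card K l) else fibre_card K l)"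
proof -
  have "{j'. (l, j') \<in> insert (i, j) K} = (if l = i then insert j {j'. (l, j') \<in> K} else {j'. (l, j') \<in> K})"
    by auto
  then show ?thesis using assms by (simp add: fibre_card_def finite_fibre)
qed

lemma sum_fun_apply: "(\<Sum>a\<in>A. f a) x = (\<Sum>a\<in>A. f a x)"
  by (induction A rule: infinite_finite_induct) auto

locale distinct_simples =
  fixes n :: nat and S :: "'i::finite \<Rightarrow> ('k::field, 'w::ab_group_add) perm_module"
  assumes simple: "Sn_simple n (S i)"
    and distinct: "Sn_iso n (S i) (S j) \<Longrightarrow> i = j"
begin

lemma summand_module: "Sn_module n (S i)"
  using simple by (simp add: Sn_simple_def)

lemma dsum_module: "Sn_module n (Sn_dsum m S)"
  by (rule Sn_dsum_module[OF summand_module])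

sublocale S: Sn_module n "S i" for i by (rule summand_module)
sublocale D: Sn_module n "Sn_dsum m S" for m by (rule dsum_module)

lemma scal_dsum [simp]: "scal (Sn_dsum m S) c f a = scal (S (fst a)) c (f a)"
  by (simp add: Sn_dsum_def case_prod_unfold)

lemma act_dsum [simp]: "act (Sn_dsum m S) p f a = act (S (fst a)) p (f a)"
  by (simp add: Sn_dsum_def case_prod_unfold)

lemma mem_dsum: "f \<in> underlying (Sn_dsum m S) \<longleftrightarrow>
    (\<forall>a. f a \<in> underlying (S (fst a))) \<and> (\<forall>a. a \<notin> positions m \<longrightarrow> f a = 0)"
  unfolding Sn_dsum_def positions_def by (auto simp: S.zero_mem split_paired_all) (metis S.zero_mem)

lemma component_mem: "f \<in> underlying (Sn_dsum m S) \<Longrightarrow> f a \<in> underlying (S (fst a))"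
  unfolding mem_dsum by blast

lemma component_outside: "\<lbrakk>f \<in> underlying (Sn_dsum m S); a \<notin> positions m\<rbrakk> \<Longrightarrow> f a = 0"
  unfolding mem_dsum by blast

lemma ex_nonzero: "\<exists>x\<in>underlying (S i). x \<noteq> 0"
  using simple[of i] S.zero_mem[of i] by (auto simp: Sn_simple_def)

text \<open>The internal direct sum of the summands at the positions in \<open>J\<close>.\<close>

definition copies :: "('i \<Rightarrow> nat) \<Rightarrow> ('i \<times> nat) set \<Rightarrow> ('i \<times> nat \<Rightarrow> 'w) set" where
  "copies m J = {f \<in> underlying (Sn_dsum m S). \<forall>a. a \<notin> J \<longrightarrow> f a = 0}"

lemma submodule_copies: "Sn_submodule n (Sn_dsum m S) (copies m J)"
  unfolding Sn_submodule_def D.subspace_def copies_def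
  by (auto simp: D.zero_mem D.add_mem D.scale_mem D.act_closed S.act_zero)

lemma copies_outside: "\<lbrakk>f \<in> copies m J; a \<notin> J\<rbrakk> \<Longrightarrow> f a = 0"
  unfolding copies_def by blast

lemma copies_empty: "copies m {} = {0}"
  by (auto simp: copies_def D.zero_mem fun_eq_iff)

lemma copies_mono: "J \<subseteq> K \<Longrightarrow> copies m J \<subseteq> copies m K"
  by (auto simp: copies_def)

lemma copies_zero: "0 \<in> copies m J"
  by (simp add: copies_def D.zero_mem)

lemma copies_add: "\<lbrakk>f \<in> copies m J; g \<in> copies m J\<rbrakk> \<Longrightarrow> f + g \<in> copies m J"
  by (simp add: copies_def D.add_mem)

lemma copies_diff: "\<lbrakk>f \<in> copies m J; g \<in> copies m J\<rbrakk> \<Longrightarrow> f - g \<in> copies m J"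
  by (simp add: copies_def D.diff_mem)

lemma single_mem_copies:
  "\<lbrakk>a \<in> positions m; a \<in> J; x \<in> underlying (S (fst a))\<rbrakk> \<Longrightarrow> single a x \<in> copies m J"
  by (auto simp: copies_def mem_dsum single_def S.zero_mem)

lemma single_mem: "\<lbrakk>a \<in> positions m; x \<in> underlying (S (fst a))\<rbrakk> \<Longrightarrow> single a x \<in> underlying (Sn_dsum m S)"
  using single_mem_copies[of a m UNIV x] by (simp add: copies_def)

lemma hom_single: "a \<in> positions m \<Longrightarrow> Sn_hom n (S (fst a)) (Sn_dsum m S) (single a)"
  unfolding Sn_hom_def by (auto simp: single_mem fun_eq_iff) (auto simp: single_def S.act_zero)

lemma hom_component: "Sn_hom n (Sn_dsum m S) (S (fst a)) (\<lambda>f. f a)"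
  by (auto simp: Sn_hom_def component_mem)

lemma sum_singles:
  assumes "f \<in> underlying (Sn_dsum m S)"
  shows "f = (\<Sum>a\<in>positions m. single a (f a))"
proof
  fix b
  have "(\<Sum>a\<in>positions m. single a (f a) b) = (\<Sum>a\<in>positions m. if a = b then f a else 0)"
    by (rule sum.cong) (auto simp: single_def)
  then show "f b = (\<Sum>a\<in>positions m. single a (f a)) b"
    using component_outside[OF assms] finite_positions[of m] by (simp add: sum_fun_apply)
qed

text \<open>The sum of the submodules \<open>W\<close> and \<open>copies m K\<close>.\<close>

definition plus_copies ::
  "('i \<Rightarrow> nat) \<Rightarrow> ('i \<times> nat \<Rightarrow> 'w) set \<Rightarrow> ('i \<times> nat) set \<Rightarrow> ('i \<times> nat \<Rightarrow> 'w) set" where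
  "plus_copies m W K = {f \<in> underlying (Sn_dsum m S). \<exists>w\<in>W. f - w \<in> copies m K}"

lemma submodule_plus_copies:
  assumes W: "Sn_submodule n (Sn_dsum m S) W"
  shows "Sn_submodule n (Sn_dsum m S) (plus_copies m W K)"
proof -
  have WU: "w \<in> underlying (Sn_dsum m S)" if "w \<in> W" for w using W that by (auto simp: Sn_submodule_def)
  have ss: "D.subspace m W" and actW: "\<And>p w. p permutes {1..n} \<Longrightarrow> w \<in> W \<Longrightarrow> act (Sn_dsum m S) p w \<in> W"
    using W by (auto simp: Sn_submodule_def)
  have ssK: "D.subspace m (copies m K)"
    and actK: "\<And>p w. p permutes {1..n} \<Longrightarrow> w \<in> copies m K \<Longrightarrow> act (Sn_dsum m S) p w \<in> copies m K"
    using submodule_copies[of m K] by (auto simp: Sn_submodule_def)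
  have "D.subspace m (plus_copies m W K)"
    unfolding D.subspace_def
  proof (intro conjI ballI allI)
    show "0 \<in> plus_copies m W K"
      using D.subspace_0[OF ss] by (auto simp: plus_copies_def D.zero_mem copies_zero intro!: bexI[of _ 0])
    fix f assume "f \<in> plus_copies m W K"
    then obtain w where f: "f \<in> underlying (Sn_dsum m S)" "w \<in> W" "f - w \<in> copies m K"
      by (auto simp: plus_copies_def)
    show "scal (Sn_dsum m S) c f \<in> plus_copies m W K" for c
      using f D.subspace_scale[OF ss, of w c] D.subspace_scale[OF ssK f(3), of c]
      by (auto simp: plus_copies_def D.scale_mem D.scale_right_diff_distrib)
    fix g assume "g \<in> plus_copies m W K"
    then obtain w' where g: "g \<in> underlying (Sn_dsum m S)" "w' \<in> W" "g - w' \<in> copies m K"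
      by (auto simp: plus_copies_def)
    have "(f + g) - (w + w') \<in> copies m K"
      using copies_add[OF f(3) g(3)] by (simp add: algebra_simps)
    then show "f + g \<in> plus_copies m W K"
      using f g D.subspace_add[OF ss, of w w'] by (auto simp: plus_copies_def D.add_mem)
  qed
  moreover have "act (Sn_dsum m S) p f \<in> plus_copies m W K"
    if p: "p permutes {1..n}" and "f \<in> plus_copies m W K" for p f
  proof -
    obtain w where f: "f \<in> underlying (Sn_dsum m S)" "w \<in> W" "f - w \<in> copies m K"
      using \<open>f \<in> _\<close> by (auto simp: plus_copies_def)
    have "act (Sn_dsum m S) p (w + (f - w)) = act (Sn_dsum m S) p w + act (Sn_dsum m S) p (f - w)"
      by (rule D.act_add[OF p WU[OF f(2)] D.diff_mem[OF f(1) WU[OF f(2)]]])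
    then have "act (Sn_dsum m S) p f - act (Sn_dsum m S) p w \<in> copies m K"
      using actK[OF p f(3)] by simp
    then show ?thesis using actW[OF p f(2)] D.act_closed[OF p f(1)] by (auto simp: plus_copies_def)
  qed
  ultimately show ?thesis by (auto simp: Sn_submodule_def plus_copies_def)
qed

text \<open>
  A complement is not allowed to be an arbitrary submodule: it has to be the sum of the summands at
  the positions in \<open>J\<close>.  Then the positions outside \<open>J\<close> give the multiplicities in \<open>W\<close>.
\<close>

definition complement ::
  "('i \<Rightarrow> nat) \<Rightarrow> ('i \<times> nat \<Rightarrow> 'w) set \<Rightarrow> ('i \<times> nat) set \<Rightarrow> bool" where
  "complement m W J \<longleftrightarrow> Sn_submodule n (Sn_dsum m S) W \<and> J \<subseteq> positions m \<and>
     W \<inter> copies m J \<subseteq> {0} \<and> plus_copies m W J = underlying (Sn_dsum m S)"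

text \<open>
  Take \<open>J\<close> of greatest size such that \<open>W\<close> meets \<open>copies m J\<close> trivially.  Adding a position \<open>a\<close> to
  \<open>J\<close> yields a nonzero \<open>w \<in> W\<close> supported on \<open>J\<close> and \<open>a\<close>, and \<open>w a \<noteq> 0\<close>.  So the sum of \<open>W\<close> and
  \<open>copies m J\<close> contains a nonzero vector of the simple summand at \<open>a\<close>, hence this summand.
\<close>

lemma exists_complement:
  assumes W: "Sn_submodule n (Sn_dsum m S) W"
  shows "\<exists>J. complement m W J"
proof -
  let ?P = "\<lambda>J. J \<subseteq> positions m \<and> W \<inter> copies m J \<subseteq> {0}"
  have "?P {}" by (simp add: copies_empty)
  moreover have "\<forall>J. ?P J \<longrightarrow> card J \<le> card (positions m)"
    by (auto intro: card_mono finite_positions)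
  ultimately obtain J where J: "J \<subseteq> positions m" "W \<inter> copies m J \<subseteq> {0}"
    and max: "\<And>K. ?P K \<Longrightarrow> card K \<le> card J"
    using ex_has_greatest_nat[of ?P "{}" card "Suc (card (positions m))"]
    by (auto simp: less_Suc_eq_le)
  have finJ: "finite J" by (rule finite_subset[OF J(1) finite_positions])
  let ?Z = "plus_copies m W J"
  have Z: "Sn_submodule n (Sn_dsum m S) ?Z" by (rule submodule_plus_copies[OF W])
  have W0: "0 \<in> W" using W D.subspace_0 by (auto simp: Sn_submodule_def)
  have single_Z: "single a x \<in> ?Z" if a: "a \<in> positions m" and x: "x \<in> underlying (S (fst a))" for a x
  proof (cases "a \<in> J")
    case True
    then show ?thesis
      using single_mem_copies[OF a True x] single_mem[OF a x] W0
      by (auto simp: plus_copies_def intro!: bexI[of _ 0])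
  next
    case False
    then have "\<not> ?P (insert a J)" using max[of "insert a J"] finJ by auto
    then obtain w where w: "w \<in> W" "w \<in> copies m (insert a J)" "w \<noteq> 0" using a J by auto
    let ?X = "{x \<in> underlying (S (fst a)). single a x \<in> ?Z}"
    have "Sn_submodule n (S (fst a)) ?X"
      by (rule Sn_hom_vimage[OF summand_module dsum_module hom_single[OF a] Z])
    then have "?X = {0} \<or> ?X = underlying (S (fst a))" using simple[of "fst a"] by (simp add: Sn_simple_def)
    moreover have "w a \<in> ?X"
    proof -
      have wU: "w \<in> underlying (Sn_dsum m S)" using w by (simp add: copies_def)
      then have wa: "w a \<in> underlying (S (fst a))" by (rule component_mem)
      have "single a (w a) - w \<in> copies m J"
        using w(2) D.diff_mem[OF single_mem[OF a wa] wU] by (auto simp: copies_def single_def)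
      then show ?thesis using w(1) wa single_mem[OF a wa] by (auto simp: plus_copies_def)
    qed
    moreover have "w a \<noteq> 0"
    proof
      assume "w a = 0"
      then have "w \<in> copies m J" using w(2) by (auto simp: copies_def)
      then show False using J(2) w by blast
    qed
    ultimately have "?X = underlying (S (fst a))" by blast
    then show ?thesis using x by blast
  qed
  have "f \<in> ?Z" if f: "f \<in> underlying (Sn_dsum m S)" for f
  proof -
    have "D.subspace m ?Z" using Z by (simp add: Sn_submodule_def)
    then have "(\<Sum>a\<in>positions m. single a (f a)) \<in> ?Z"
      by (rule D.subspace_sum) (use f in \<open>auto intro: single_Z component_mem\<close>)
    then show ?thesis using sum_singles[OF f] by simp
  qed
  then have "?Z = underlying (Sn_dsum m S)" by (auto simp: plus_copies_def)
  then show ?thesis using W J by (auto simp: complement_def)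
qed

text \<open>
  Forget the components at \<open>J\<close>.  The kernel of this projection is \<open>copies m J\<close>, so on \<open>W\<close> it is
  injective, and no image is lost by restricting it to \<open>W\<close>.  The bijections \<open>e i\<close> renumber the
  remaining copies of \<open>S i\<close>.
\<close>

lemma complement_iso:
  assumes "complement m W J"
  shows "Sn_iso n ((Sn_dsum m S)\<lparr>underlying := W\<rparr>) (Sn_dsum (fibre_card (positions m - J)) S)"
proof -
  let ?K = "positions m - J" and ?D = "Sn_dsum m S"
  have W: "Sn_submodule n ?D W" and meet: "W \<inter> copies m J \<subseteq> {0}"
    and join: "plus_copies m W J = underlying ?D"
    using assms by (auto simp: complement_def)
  have WU: "w \<in> underlying ?D" if "w \<in> W" for w using W that by (auto simp: Sn_submodule_def)
  have "finite {j. (i, j) \<in> ?K}" for i by (rule finite_fibre) (simp add: finite_positions)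
  then have "\<exists>e. bij_betw e {..<fibre_card ?K i} {j. (i, j) \<in> ?K}" for i
    using ex_bij_betw_nat_finite unfolding fibre_card_def atLeast0LessThan by blast
  then obtain e where e: "bij_betw (e i) {..<fibre_card ?K i} {j. (i, j) \<in> ?K}" for i by metis
  define h where "h w = (\<lambda>(i, j). if j < fibre_card ?K i then w (i, e i j) else 0)" for w :: "'i \<times> nat \<Rightarrow> 'w"
  have hU: "h w \<in> underlying (Sn_dsum (fibre_card ?K) S)" if "w \<in> underlying ?D" for w
    using that by (auto simp: mem_dsum h_def positions_def S.zero_mem)
  have h_diff: "h (u - v) = h u - h v" for u v by (auto simp: h_def fun_eq_iff)
  have ker: "w \<in> copies m J" if "w \<in> underlying ?D" "h w = 0" for w
  proof -
    have "w (i, j) = 0" if ij: "(i, j) \<in> ?K" for i j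
    proof -
      obtain q where q: "q < fibre_card ?K i" "j = e i q"
        using e[of i] ij by (auto simp: bij_betw_def image_iff)
      then show ?thesis using fun_cong[OF \<open>h w = 0\<close>, of "(i, q)"] by (simp add: h_def)
    qed
    then have "w a = 0" if "a \<notin> J" for a
      using that component_outside[OF \<open>w \<in> underlying ?D\<close>, of a]
      by (cases a; cases "a \<in> positions m") auto
    then show ?thesis using that(1) by (simp add: copies_def)
  qed
  have h_copies: "h c = 0" if "c \<in> copies m J" for c
  proof -
    have "c (i, e i j) = 0" if "j < fibre_card ?K i" for i j
    proof -
      have "(i, e i j) \<in> ?K" using e[of i] that by (auto simp: bij_betw_def)
      then show ?thesis using \<open>c \<in> _\<close> by (auto simp: copies_def)
    qed
    then show ?thesis by (auto simp: h_def fun_eq_iff)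
  qed
  have "bij_betw h W (underlying (Sn_dsum (fibre_card ?K) S))"
  proof (rule bij_betw_imageI)
    show "inj_on h W"
    proof
      fix u v assume uv: "u \<in> W" "v \<in> W" "h u = h v"
      have "u - v \<in> W" using W uv D.subspace_diff by (auto simp: Sn_submodule_def)
      moreover have "u - v \<in> copies m J"
        using uv by (intro ker D.diff_mem WU) (simp_all add: h_diff)
      ultimately have "u - v = 0" using meet by blast
      then show "u = v" by simp
    qed
    show "h ` W = underlying (Sn_dsum (fibre_card ?K) S)"
    proof
      show "h ` W \<subseteq> underlying (Sn_dsum (fibre_card ?K) S)" using WU hU by blast
      show "underlying (Sn_dsum (fibre_card ?K) S) \<subseteq> h ` W"
      proof
        fix g assume g: "g \<in> underlying (Sn_dsum (fibre_card ?K) S)"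
        define f where "f = (\<lambda>(i, j). if (i, j) \<in> ?K then g (i, inv_into {..<fibre_card ?K i} (e i) j) else 0)"
        have gS: "g (i, j) \<in> underlying (S i)" for i j using g unfolding mem_dsum by (metis fst_conv)
        have "f \<in> underlying ?D" by (auto simp: mem_dsum f_def S.zero_mem gS)
        then obtain w where w: "w \<in> W" "f - w \<in> copies m J" using join by (auto simp: plus_copies_def)
        have "h f (i, j) = g (i, j)" for i j
        proof (cases "j < fibre_card ?K i")
          case True
          then have "(i, e i j) \<in> ?K" "inv_into {..<fibre_card ?K i} (e i) (e i j) = j"
            using e[of i] by (auto simp: bij_betw_def)
          then show ?thesis using True by (simp add: h_def f_def)
        next
          case False
          then show ?thesis using g by (auto simp: h_def mem_dsum positions_def)
        qed
        then have "h f = g" by auto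
        moreover have "h f = h w" using h_copies[OF w(2)] by (simp add: h_diff)
        ultimately show "g \<in> h ` W" using w(1) by blast
      qed
    qed
  qed
  then show ?thesis
    unfolding Sn_iso_def by (intro exI[of _ h]) (auto simp: h_def fun_eq_iff S.act_zero)
qed

text \<open>The summand at \<open>a\<close> is moved from the complement to \<open>W\<close>.\<close>

lemma complement_shrink:
  assumes J: "complement m W J" and a: "a \<in> J"
  shows "\<exists>W'. W \<subset> W' \<and> complement m W' (J - {a})"
proof -
  let ?D = "Sn_dsum m S" and ?W' = "plus_copies m W {a}"
  have W: "Sn_submodule n ?D W" and JI: "J \<subseteq> positions m" and meet: "W \<inter> copies m J \<subseteq> {0}"
    and join: "plus_copies m W J = underlying ?D"
    using J by (auto simp: complement_def)
  have aI: "a \<in> positions m" using a JI by blast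
  have W0: "0 \<in> W" using W D.subspace_0 by (auto simp: Sn_submodule_def)
  have WU: "w \<in> underlying ?D" if "w \<in> W" for w using W that by (auto simp: Sn_submodule_def)
  have WW': "W \<subseteq> ?W'" using WU copies_zero[of m "{a}"] unfolding plus_copies_def by (force intro: rev_bexI)
  have single': "single a x \<in> ?W'" if "x \<in> underlying (S (fst a))" for x
    using that W0 aI by (auto simp: plus_copies_def single_mem single_mem_copies intro!: bexI[of _ 0])
  obtain x where x: "x \<in> underlying (S (fst a))" "x \<noteq> 0" using ex_nonzero by blast
  have "single a x \<notin> W"
  proof
    assume "single a x \<in> W"
    then have "single a x = 0" using meet single_mem_copies[OF aI a x(1)] by blast
    then have "single a x a = 0" by simp
    then show False using x(2) by (simp add: single_def)
  qed
  then have "W \<subset> ?W'" using WW' single'[OF x(1)] by blast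
  moreover have "complement m ?W' (J - {a})"
    unfolding complement_def
  proof (intro conjI)
    show "Sn_submodule n ?D ?W'" by (rule submodule_plus_copies[OF W])
    show "J - {a} \<subseteq> positions m" using JI by blast
    show "?W' \<inter> copies m (J - {a}) \<subseteq> {0}"
    proof
      fix f assume f: "f \<in> ?W' \<inter> copies m (J - {a})"
      then obtain w where w: "w \<in> W" "f - w \<in> copies m {a}" by (auto simp: plus_copies_def)
      have "f - (f - w) \<in> copies m J"
        by (rule copies_diff)
          (use f w(2) a copies_mono[of "J - {a}" J m] copies_mono[of "{a}" J m] in auto)
      then have "w = 0" using w(1) meet by auto
      then have "f \<in> copies m {a}" using w(2) by simp
      then have "f b = 0" for b
        using f copies_outside[of f m "{a}" b] copies_outside[of f m "J - {a}" b] by blast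
      then show "f \<in> {0}" by auto
    qed
    show "plus_copies m ?W' (J - {a}) = underlying ?D"
    proof
      show "plus_copies m ?W' (J - {a}) \<subseteq> underlying ?D" by (auto simp: plus_copies_def)
      show "underlying ?D \<subseteq> plus_copies m ?W' (J - {a})"
      proof
        fix f assume f: "f \<in> underlying ?D"
        then obtain w where w: "w \<in> W" "f - w \<in> copies m J" using join by (auto simp: plus_copies_def)
        define s where "s = single a ((f - w) a)"
        have fw: "(f - w) a \<in> underlying (S (fst a))" using w(2) unfolding copies_def by (blast intro: component_mem)
        have sU: "s \<in> underlying ?D" "s \<in> copies m {a}"
          using single_mem[OF aI fw] single_mem_copies[OF aI _ fw] by (auto simp: s_def)
        have "w + s \<in> ?W'" using w(1) sU WU by (auto simp: plus_copies_def D.add_mem intro!: bexI[of _ w])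
        moreover have "f - (w + s) \<in> copies m (J - {a})"
          using copies_outside[OF w(2)] D.diff_mem[OF f D.add_mem[OF WU[OF w(1)] sU(1)]]
          by (auto simp: copies_def s_def single_def algebra_simps)
        ultimately show "f \<in> plus_copies m ?W' (J - {a})" using f by (auto simp: plus_copies_def)
      qed
    qed
  qed
  ultimately show ?thesis by blast
qed

text \<open>An instance of the modular law: the \<open>copies m J\<close>-part of an element of \<open>W'\<close> lies in \<open>W'\<close>.\<close>

lemma complement_modular:
  assumes W: "complement m W J" and W': "complement m W' J" and sub: "W \<subseteq> W'"
  shows "W' = W"
proof
  show "W' \<subseteq> W"
  proof
    fix f assume f: "f \<in> W'"
    have ss: "D.subspace m W'" and "f \<in> underlying (Sn_dsum m S)"
      using W' f by (auto simp: complement_def Sn_submodule_def)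
    then have "f \<in> plus_copies m W J" using W by (simp add: complement_def)
    then obtain w where w: "w \<in> W" "f - w \<in> copies m J" by (auto simp: plus_copies_def)
    moreover have "f - w \<in> W'" using D.subspace_diff[OF ss f] w(1) sub by blast
    ultimately have "f - w = 0" using W' unfolding complement_def by blast
    then show "f \<in> W" using w(1) by simp
  qed
qed (rule sub)

lemma complement_copies:
  assumes "K \<subseteq> positions m"
  shows "complement m (copies m K) (positions m - K)"
  unfolding complement_def
proof (intro conjI submodule_copies)
  show "copies m K \<inter> copies m (positions m - K) \<subseteq> {0}"
  proof
    fix f assume f: "f \<in> copies m K \<inter> copies m (positions m - K)"
    then have "f b = 0" for b
      using copies_outside[of f m K b] copies_outside[of f m "positions m - K" b] by blast
    then show "f \<in> {0}" by auto
  qed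
  have "f \<in> plus_copies m (copies m K) (positions m - K)" if f: "f \<in> underlying (Sn_dsum m S)" for f
  proof -
    define g where "g a = (if a \<in> K then f a else 0)" for a
    have g: "g \<in> copies m K" using f assms component_mem[OF f] component_outside[OF f]
      by (simp add: copies_def mem_dsum g_def S.zero_mem del: split_paired_All)
    moreover have "f - g \<in> underlying (Sn_dsum m S)"
      using f g by (auto simp: copies_def intro: D.diff_mem)
    then have "f - g \<in> copies m (positions m - K)"
      using component_outside[OF f] by (auto simp: copies_def g_def)
    ultimately show ?thesis using f by (auto simp: plus_copies_def)
  qed
  then show "plus_copies m (copies m K) (positions m - K) = underlying (Sn_dsum m S)"
    by (auto simp: plus_copies_def)
qed auto

end

section \<open>Generation of a direct sum of simple modules\<close>

text \<open>
  A homogeneous linear system with fewer equations than unknowns: if the equation \<open>e\<close> involves the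
  unknown \<open>k\<close>, it is used to eliminate \<open>k\<close> from the others.
\<close>

lemma homogeneous_system_solution:
  fixes c :: "'a \<Rightarrow> 'e \<Rightarrow> 'k::field"
  assumes "finite E" "finite J" "card E < card J"
  shows "\<exists>a. (\<exists>j\<in>J. a j \<noteq> 0) \<and> (\<forall>e\<in>E. (\<Sum>j\<in>J. a j * c j e) = 0)"
  using assms
proof (induction E arbitrary: J c rule: finite_induct)
  case empty
  then obtain j where "j \<in> J" by fastforce
  then show ?case by (intro exI[of _ "\<lambda>_. 1"]) auto
next
  case (insert e E)
  show ?case
  proof (cases "\<forall>j\<in>J. c j e = 0")
    case True
    obtain a where "\<exists>j\<in>J. a j \<noteq> 0" "\<forall>e\<in>E. (\<Sum>j\<in>J. a j * c j e) = 0"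
      using insert.IH[of J c] insert.prems insert.hyps by auto
    then show ?thesis using True by (intro exI[of _ a]) auto
  next
    case False
    then obtain k where k: "k \<in> J" "c k e \<noteq> 0" by blast
    let ?J = "J - {k}"
    have "card E < card ?J" using insert k by simp
    then obtain a where a: "\<exists>j\<in>?J. a j \<noteq> 0"
      "\<forall>e'\<in>E. (\<Sum>j\<in>?J. a j * (c j e' - c j e / c k e * c k e')) = 0"
      using insert.IH[of ?J "\<lambda>j e'. c j e' - c j e / c k e * c k e'"] insert.prems by auto
    define b where "b = (\<lambda>j. if j = k then - (\<Sum>j\<in>?J. a j * c j e) / c k e else a j)"
    have sum: "(\<Sum>j\<in>J. b j * c j e') =
        (\<Sum>j\<in>?J. a j * c j e') - (\<Sum>j\<in>?J. a j * c j e) / c k e * c k e'" for e'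
      using k insert.prems by (subst sum.remove[of _ k]) (auto simp: b_def intro!: sum.cong)
    have "(\<Sum>j\<in>J. b j * c j e') = 0" if "e' \<in> insert e E" for e'
    proof (cases "e' = e")
      case True
      then show ?thesis using k unfolding sum by simp
    next
      case False
      then have "(\<Sum>j\<in>?J. a j * (c j e' - c j e / c k e * c k e')) = 0" using a(2) that by blast
      then show ?thesis
        unfolding sum
        by (simp add: right_diff_distrib sum_subtractf sum_distrib_right sum_divide_distrib mult.assoc)
    qed
    moreover have "\<exists>j\<in>J. b j \<noteq> 0" using a(1) by (auto simp: b_def)
    ultimately show ?thesis by blast
  qed
qed

context Sn_module
begin

lemma simple_basis:
  assumes "Sn_simple n M"
  obtains b where "inj_on b {..<Sn_dim M}"
    "independent (b ` {..<Sn_dim M})" "span (b ` {..<Sn_dim M}) = underlying M"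
proof -
  obtain v where v: "v \<in> underlying M" "v \<noteq> 0"
    using assms zero_mem by (auto simp: Sn_simple_def)
  let ?O = "(\<lambda>p. act M p v) ` {p. p permutes {1..n}}"
  have finO: "finite ?O" by (intro finite_imageI finite_permutations) simp
  obtain B where B: "B \<subseteq> underlying M" "independent B" "underlying M \<subseteq> span B"
    "card B = dim (underlying M)"
    by (rule basis_exists)
  have "finite B"
    using independent_span_bound[OF finO B(2)] B(1) simple_eq_orbit_span[OF assms v] by simp
  then obtain b where b: "bij_betw b {..<card B} B"
    using ex_bij_betw_nat_finite unfolding atLeast0LessThan by blast
  have "span B = underlying M" using B span_minimal[OF B(1) subspace_underlying] by blast
  moreover have "b ` {..<Sn_dim M} = B" "inj_on b {..<Sn_dim M}"
    using b B(4) by (simp_all add: bij_betw_def Sn_dim_def)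
  ultimately show thesis using that[of b] B(2) by simp
qed

end

context distinct_simples
begin

text \<open>
  The components of the \<open>r\<close> generators at the copies of \<open>S i\<close>, in coordinates, are \<open>l i\<close> vectors with
  \<open>r * Sn_dim (S i)\<close> entries.  If \<open>l i\<close> is greater, they satisfy a nontrivial linear relation.  It defines a
  homomorphism \<open>L\<close> to \<open>S i\<close> that vanishes on the generators, but not on the copies with a
  nonzero coefficient.
\<close>

lemma generated_dsum_le:
  assumes "Sn_generated n r (Sn_dsum l S)"
  shows "l i \<le> r * Sn_dim (S i)"
proof (rule ccontr)
  assume gt: "\<not> l i \<le> r * Sn_dim (S i)"
  let ?d = "Sn_dim (S i)" and ?D = "Sn_dsum l S"
  obtain b where b: "inj_on b {..<?d}"
    "S.independent i (b ` {..<?d})" "S.span i (b ` {..<?d}) = underlying (S i)"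
    using S.simple_basis[OF simple] by blast
  let ?B = "b ` {..<?d}"
  obtain f where f: "\<And>t. t \<in> {1..r} \<Longrightarrow> f t \<in> underlying ?D"
    and gen: "\<And>X. \<lbrakk>Sn_submodule n ?D X; \<forall>t\<in>{1..r}. f t \<in> X\<rbrakk> \<Longrightarrow> X = underlying ?D"
    using assms unfolding Sn_generated_iff[OF dsum_module] by blast
  have "card ({1..r} \<times> ?B) < card {..<l i}"
    using gt b(1) by (simp add: card_cartesian_product card_image)
  then obtain a where a1: "\<exists>j\<in>{..<l i}. a j \<noteq> 0"
    and "\<forall>e\<in>{1..r} \<times> ?B. (\<Sum>j<l i. a j * S.representation i ?B (f (fst e) (i, j)) (snd e)) = 0"
    using homogeneous_system_solution[of "{1..r} \<times> ?B" "{..<l i}"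
        "\<lambda>j e. S.representation i ?B (f (fst e) (i, j)) (snd e)"]
    by blast
  then have a2: "(\<Sum>j<l i. a j * S.representation i ?B (f t (i, j)) x) = 0"
    if "t \<in> {1..r}" "x \<in> ?B" for t x
    using that by force
  define L where "L g = (\<Sum>j<l i. scal (S i) (a j) (g (i, j)))" for g :: "'i \<times> nat \<Rightarrow> 'w"
  have comp: "g (i, j) \<in> underlying (S i)" if "g \<in> underlying ?D" for g j
    using component_mem[OF that, of "(i, j)"] by simp
  have "Sn_hom n ?D (S i) L"
    unfolding Sn_hom_def L_def
    by (auto simp: comp S.scale_mem S.act_sum S.act_scal S.scale_right_distrib sum.distrib
        S.scale_sum_right mult.commute intro!: S.sum_mem)
  then have sub: "Sn_submodule n ?D {g \<in> underlying ?D. L g \<in> {0}}"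
    by (rule Sn_hom_vimage[OF dsum_module summand_module _ Sn_submodule_zero[OF summand_module]])
  have "L (f t) = 0" if t: "t \<in> {1..r}" for t
  proof -
    have "L (f t) = (\<Sum>j<l i. scal (S i) (a j)
        (\<Sum>x\<in>?B. scal (S i) (S.representation i ?B (f t (i, j)) x) x))"
      unfolding L_def
      by (subst S.sum_representation_eq[OF b(2)]) (simp_all add: b(3) comp[OF f[OF t]])
    also have "\<dots> = (\<Sum>x\<in>?B. scal (S i) (\<Sum>j<l i. a j * S.representation i ?B (f t (i, j)) x) x)"
      by (simp add: S.scale_sum_right S.scale_sum_left) (rule sum.swap)
    also have "\<dots> = 0" using a2[OF t] by (intro sum.neutral) auto
    finally show ?thesis .
  qed
  then have all: "{g \<in> underlying ?D. L g \<in> {0}} = underlying ?D" using f by (intro gen sub) auto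
  obtain k where k: "k < l i" "a k \<noteq> 0" using a1 by auto
  obtain x where x: "x \<in> underlying (S i)" "x \<noteq> 0" using ex_nonzero by blast
  have "L (single (i, k) x) = (\<Sum>j<l i. if j = k then scal (S i) (a k) x else 0)"
    unfolding L_def by (rule sum.cong) (auto simp: single_def)
  also have "\<dots> = scal (S i) (a k) x" using k by simp
  finally have "L (single (i, k) x) \<noteq> 0" using k x by simp
  moreover have "single (i, k) x \<in> underlying ?D"
    using k x by (intro single_mem) (auto simp: positions_def)
  ultimately show False using all by blast
qed

text \<open>
  By Schur's lemma \<open>h\<close> vanishes on the copies of the other simple modules, and on each copy of
  \<open>S i\<close> it is an endomorphism, hence a scalar.
\<close>

lemma dsum_functional_eq:
  assumes char: "CHAR('k) = 0 \<or> CHAR('k) > n"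
    and h: "Sn_hom n (Sn_dsum l S) (S i) h"
  obtains c where "\<And>f. f \<in> underlying (Sn_dsum l S) \<Longrightarrow> h f = (\<Sum>j<l i. scal (S i) (c j) (f (i, j)))"
proof -
  let ?D = "Sn_dsum l S"
  have hs: "Sn_hom n (S (fst a)) (S i) (\<lambda>x. h (single a x))" if "a \<in> positions l" for a
    using Sn_hom_comp[OF hom_single[OF that] h] .
  have "\<exists>c. \<forall>x\<in>underlying (S i). h (single (i, j) x) = scal (S i) c x" if j: "j < l i" for j
  proof -
    have "Sn_hom n (S i) (S i) (\<lambda>x. h (single (i, j) x))"
      using hs[of "(i, j)"] j by (simp add: positions_def)
    then show ?thesis by (rule simple_endomorphism_scalar[OF char simple]) blast
  qed
  then obtain c where c: "\<And>j x. \<lbrakk>j < l i; x \<in> underlying (S i)\<rbrakk> \<Longrightarrow> h (single (i, j) x) = scal (S i) (c j) x"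
    by metis
  have zero: "h (single a x) = 0"
    if a: "a \<in> positions l" "fst a \<noteq> i" and x: "x \<in> underlying (S (fst a))" for a x
    using simple_hom_iso[OF simple simple hs[OF a(1)] x] distinct a(2) by blast
  show thesis
  proof
    fix f assume f: "f \<in> underlying ?D"
    have mem: "f a \<in> underlying (S (fst a))" for a by (rule component_mem[OF f])
    have "h f = h (\<Sum>a\<in>positions l. single a (f a))" using sum_singles[OF f] by simp
    also have "\<dots> = (\<Sum>a\<in>positions l. h (single a (f a)))"
      using mem by (intro Sn_hom_sum[OF dsum_module h] single_mem)
    also have "\<dots> = (\<Sum>a\<in>Pair i ` {..<l i}. h (single a (f a)))"
      by (rule sum.mono_neutral_right[OF finite_positions]) (auto simp: positions_def intro!: zero mem component_mem[OF f, of "(_, _)", simplified])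
    also have "\<dots> = (\<Sum>j<l i. h (single (i, j) (f (i, j))))"
      by (subst sum.reindex) (auto simp: inj_on_def)
    also have "\<dots> = (\<Sum>j<l i. scal (S i) (c j) (f (i, j)))"
      using mem[of "(i, _)"] by (intro sum.cong c) auto
    finally show "h f = (\<Sum>j<l i. scal (S i) (c j) (f (i, j)))" .
  qed
qed

text \<open>Project along \<open>X\<close> to \<open>copies l J\<close> and take the component at \<open>a\<close>.\<close>

lemma complement_functional:
  assumes J: "complement l X J" and a: "a \<in> J"
  obtains h where "Sn_hom n (Sn_dsum l S) (S (fst a)) h" "\<And>f. f \<in> X \<Longrightarrow> h f = 0"
    "\<And>x. x \<in> underlying (S (fst a)) \<Longrightarrow> h (single a x) = x"
proof -
  let ?D = "Sn_dsum l S"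
  have X: "Sn_submodule n ?D X" and meet: "X \<inter> copies l J \<subseteq> {0}"
    and join: "plus_copies l X J = underlying ?D" and aI: "a \<in> positions l"
    using J a by (auto simp: complement_def)
  have ssX: "D.subspace l X" and actX: "\<And>p w. p permutes {1..n} \<Longrightarrow> w \<in> X \<Longrightarrow> act ?D p w \<in> X"
    and XU: "X \<subseteq> underlying ?D"
    using X by (auto simp: Sn_submodule_def)
  have ssJ: "D.subspace l (copies l J)"
    and actJ: "\<And>p w. p permutes {1..n} \<Longrightarrow> w \<in> copies l J \<Longrightarrow> act ?D p w \<in> copies l J"
    and JU: "copies l J \<subseteq> underlying ?D"
    using submodule_copies[of l J] by (auto simp: Sn_submodule_def)
  have "\<exists>c\<in>copies l J. f - c \<in> X" if "f \<in> underlying ?D" for f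
  proof -
    have "f \<in> plus_copies l X J" using that join by simp
    then obtain w where "w \<in> X" "f - w \<in> copies l J" by (auto simp: plus_copies_def)
    then show ?thesis by (intro bexI[of _ "f - w"]) simp_all
  qed
  then obtain P where P: "\<And>f. f \<in> underlying ?D \<Longrightarrow> P f \<in> copies l J"
    "\<And>f. f \<in> underlying ?D \<Longrightarrow> f - P f \<in> X"
    by metis
  have unique: "P f = c" if "f \<in> underlying ?D" "c \<in> copies l J" "f - c \<in> X" for f c
  proof -
    have "(f - c) - (f - P f) \<in> X" by (rule D.subspace_diff[OF ssX that(3) P(2)[OF that(1)]])
    moreover have "P f - c \<in> copies l J" by (rule copies_diff[OF P(1)[OF that(1)] that(2)])
    ultimately have "P f - c = 0" using meet by auto
    then show ?thesis by simp
  qed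
  have "Sn_hom n ?D ?D P"
    unfolding Sn_hom_def
  proof (intro conjI ballI allI impI)
    fix f assume f: "f \<in> underlying ?D"
    show "P f \<in> underlying ?D" using P(1)[OF f] JU by blast
    show "P (scal ?D c f) = scal ?D c (P f)" for c
      using D.subspace_scale[OF ssX P(2)[OF f], of c]
      by (intro unique D.scale_mem f D.subspace_scale[OF ssJ P(1)[OF f]])
        (simp add: D.scale_right_diff_distrib)
    show "P (f + g) = P f + P g" if g: "g \<in> underlying ?D" for g
      using D.subspace_add[OF ssX P(2)[OF f] P(2)[OF g]]
      by (intro unique D.add_mem f g copies_add P(1)) (simp add: algebra_simps)
    show "P (act ?D p f) = act ?D p (P f)" if p: "p permutes {1..n}" for p
    proof (intro unique D.act_closed p f actJ P(1))
      have "act ?D p (P f + (f - P f)) = act ?D p (P f) + act ?D p (f - P f)"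
        using P[OF f] XU JU by (intro D.act_add p) blast+
      then have "act ?D p f - act ?D p (P f) = act ?D p (f - P f)" by simp
      then show "act ?D p f - act ?D p (P f) \<in> X" using actX[OF p P(2)[OF f]] by simp
    qed
  qed
  then have "Sn_hom n ?D (S (fst a)) (\<lambda>f. P f a)" by (rule Sn_hom_comp[OF _ hom_component])
  moreover have "P f a = 0" if "f \<in> X" for f
    using that XU unique[of f 0] by (auto simp: copies_zero)
  moreover have "P (single a x) a = x" if x: "x \<in> underlying (S (fst a))" for x
  proof -
    have "P (single a x) = single a x"
      by (rule unique) (simp_all add: single_mem single_mem_copies aI a x D.subspace_0[OF ssX])
    then show ?thesis by (simp add: single_def)
  qed
  ultimately show thesis by (rule that)
qed

text \<open>
  The generators \<open>f 1, \<dots>, f r\<close> are chosen such that for each \<open>i\<close> the \<open>l i\<close> vectors of \<open>(S i)\<^sup>r\<close> formed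
  by their components belong to a basis of \<open>(S i)\<^sup>r\<close>.  A proper submodule containing them would be
  killed by a nonzero homomorphism to some \<open>S i\<close>, that is, by a nontrivial linear relation between these vectors.
\<close>

lemma generated_dsum:
  assumes char: "CHAR('k) = 0 \<or> CHAR('k) > n"
    and le: "\<And>i. l i \<le> r * Sn_dim (S i)"
  shows "Sn_generated n r (Sn_dsum l S)"
proof -
  let ?D = "Sn_dsum l S" and ?d = "\<lambda>i. Sn_dim (S i)"
  have "\<exists>b. inj_on b {..<?d i} \<and> S.independent i (b ` {..<?d i}) \<and>
      S.span i (b ` {..<?d i}) = underlying (S i)" for i
    by (rule S.simple_basis[OF simple]) blast
  then obtain b where b: "inj_on (b i) {..<?d i}"
    "S.independent i (b i ` {..<?d i})" "S.span i (b i ` {..<?d i}) = underlying (S i)" for i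
    by metis
  have b_mem: "b i q \<in> underlying (S i)" if "q < ?d i" for i q
    using S.span_base[of "b i q" "b i ` {..<?d i}" i] that b(3)[of i] by auto
  \<comment> \<open>The vector at copy \<open>j\<close> is the basis vector \<open>j mod ?d i\<close> in slot \<open>j div ?d i\<close> of \<open>r\<close>; the slots are
    counted from \<open>0\<close>, the generators from \<open>1\<close>.\<close>
  define f where "f t = (\<lambda>(i, j). if j < l i \<and> Suc (j div ?d i) = t then b i (j mod ?d i) else 0)" for t
  have d_pos: "0 < ?d i" if "j < l i" for i j using le[of i] that by (cases "?d i") auto
  have fU: "f t \<in> underlying ?D" for t
    using d_pos by (auto simp: f_def mem_dsum positions_def S.zero_mem intro!: b_mem)
  have "X = underlying ?D" if X: "Sn_submodule n ?D X" "\<forall>t\<in>{1..r}. f t \<in> X" for X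
  proof -
    obtain J where J: "complement l X J" using exists_complement[OF X(1)] by blast
    have "J = {}"
    proof (rule ccontr)
      assume "J \<noteq> {}"
      then obtain i k where ik: "(i, k) \<in> J" by auto
      then have k: "k < l i" using J by (auto simp: complement_def positions_def)
      obtain h where h: "Sn_hom n ?D (S i) h" "\<And>f. f \<in> X \<Longrightarrow> h f = 0"
        "\<And>x. x \<in> underlying (S i) \<Longrightarrow> h (single (i, k) x) = x"
        using complement_functional[OF J ik] by auto
      obtain c where c: "\<And>f. f \<in> underlying ?D \<Longrightarrow> h f = (\<Sum>j<l i. scal (S i) (c j) (f (i, j)))"
        using dsum_functional_eq[OF char h(1)] by blast
      have c0: "c j = 0" if j: "j < l i" for j
      proof -
        let ?q = "j div ?d i"
        have dp: "0 < ?d i" by (rule d_pos[OF j])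
        \<comment> \<open>The coefficients of slot \<open>?q\<close>, padded with zeros if the copies end within the slot.\<close>
        define C where "C s = (if ?q * ?d i + s < l i then c (?q * ?d i + s) else 0)" for s
        have "?q < r" using le[of i] j dp by (simp add: div_less_iff_less_mult)
        then have "f (Suc ?q) \<in> X" using X(2) by simp
        then have "h (f (Suc ?q)) = 0" by (rule h(2))
        then have "0 = (\<Sum>j'<l i. scal (S i) (c j') (f (Suc ?q) (i, j')))"
          using c[OF fU] by simp
        also have "\<dots> = (\<Sum>j' | j' < l i \<and> j' div ?d i = ?q. scal (S i) (c j') (b i (j' mod ?d i)))"
          by (rule sum.mono_neutral_cong_right) (auto simp: f_def)
        also have "\<dots> = (\<Sum>s | s < ?d i \<and> ?q * ?d i + s < l i. scal (S i) (c (?q * ?d i + s)) (b i s))"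
          by (rule sum.reindex_bij_witness[where i = "\<lambda>s. ?q * ?d i + s" and j = "\<lambda>j. j mod ?d i"])
            (use dp in \<open>auto simp: div_mult_mod_eq\<close>, (metis div_mult_mod_eq)+)
        also have "\<dots> = (\<Sum>s<?d i. scal (S i) (C s) (b i s))"
          by (rule sum.mono_neutral_cong_left) (auto simp: C_def)
        also have "\<dots> = (\<Sum>x\<in>b i ` {..<?d i}. scal (S i) (C (inv_into {..<?d i} (b i) x)) x)"
          using b(1)[of i] by (subst sum.reindex) (auto intro!: sum.cong)
        finally have "C (inv_into {..<?d i} (b i) (b i (j mod ?d i))) = 0"
          using dp by (intro S.independentD[OF b(2)[of i] _ subset_refl]) auto
        moreover have "inv_into {..<?d i} (b i) (b i (j mod ?d i)) = j mod ?d i"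
          using b(1)[of i] dp by (intro inv_into_f_f) auto
        ultimately show "c j = 0" using j by (simp add: C_def div_mult_mod_eq)
      qed
      obtain x where x: "x \<in> underlying (S i)" "x \<noteq> 0" using ex_nonzero by blast
      have "single (i, k) x \<in> underlying ?D" using k x by (intro single_mem) (auto simp: positions_def)
      then have "h (single (i, k) x) = 0" using c c0 by simp
      then show False using h(3) x by simp
    qed
    have "f \<in> X" if "f \<in> underlying ?D" for f
    proof -
      have "f \<in> plus_copies l X J" using J that by (simp add: complement_def)
      then obtain w where "w \<in> X" "f - w = 0" unfolding \<open>J = {}\<close> by (auto simp: plus_copies_def copies_empty)
      then show ?thesis by simp
    qed
    then show ?thesis using X(1) by (auto simp: Sn_submodule_def)
  qed
  then show ?thesis unfolding Sn_generated_iff[OF dsum_module] using fU by blast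
qed

section \<open>Maximal generated submodules\<close>

lemma generated_submodule_iff:
  assumes char: "CHAR('k) = 0 \<or> CHAR('k) > n" and J: "complement m W J"
  shows "Sn_generated_submodule n r (Sn_dsum m S) W \<longleftrightarrow>
    (\<forall>i. fibre_card (positions m - J) i \<le> r * Sn_dim (S i))"
proof -
  have W: "Sn_submodule n (Sn_dsum m S) W" using J by (simp add: complement_def)
  note mod = Sn_submodule_module[OF dsum_module W]
  note iso = complement_iso[OF J]
  show ?thesis
    unfolding Sn_generated_submodule_def
    using W Sn_generated_iso[OF mod dsum_module iso] generated_dsum_le generated_dsum[OF char]
      Sn_generated_iso[OF dsum_module mod Sn_iso_sym[OF mod iso]] by blast
qed

text \<open>
  If a multiplicity of \<open>W\<close> is below both bounds, the complement of \<open>W\<close> contains a copy of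
  that simple module, and adding it to \<open>W\<close> gives a larger submodule generated by \<open>r\<close> elements.
\<close>

lemma maximal_generated_submodule_dsum_iso:
  assumes char: "CHAR('k) = 0 \<or> CHAR('k) > n"
    and max: "Sn_maximal_generated_submodule n r (Sn_dsum m S) W"
  shows "Sn_iso n ((Sn_dsum m S)\<lparr>underlying := W\<rparr>) (Sn_dsum (\<lambda>i. min (m i) (r * Sn_dim (S i))) S)"
proof -
  have gen: "Sn_generated_submodule n r (Sn_dsum m S) W"
    and top: "\<And>W'. \<lbrakk>Sn_generated_submodule n r (Sn_dsum m S) W'; W \<subseteq> W'\<rbrakk> \<Longrightarrow> W' = W"
    using max by (auto simp: Sn_maximal_generated_submodule_def)
  obtain J where J: "complement m W J"
    using exists_complement gen by (auto simp: Sn_generated_submodule_def)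
  let ?K = "positions m - J"
  have finK: "finite ?K" using finite_positions by blast
  have le: "fibre_card ?K i \<le> r * Sn_dim (S i)" for i
    using gen generated_submodule_iff[OF char J] by blast
  have "fibre_card ?K i = min (m i) (r * Sn_dim (S i))" for i
  proof (rule ccontr)
    assume ne: "\<not> ?thesis"
    have "fibre_card ?K i \<le> m i"
      using fibre_card_mono[OF finite_positions, of ?K m i] by (simp add: fibre_card_positions)
    then have lt: "fibre_card ?K i < m i" "fibre_card ?K i < r * Sn_dim (S i)"
      using ne le[of i] by auto
    have "\<exists>j. (i, j) \<in> J"
    proof (rule ccontr)
      assume "\<not> ?thesis"
      then have "{j. (i, j) \<in> ?K} = {j. (i, j) \<in> positions m}" by blast
      then have "fibre_card ?K i = m i" using fibre_card_positions[of m i] by (simp add: fibre_card_def)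
      then show False using lt by simp
    qed
    then obtain j where j: "(i, j) \<in> J" by blast
    obtain W' where W': "W \<subset> W'" "complement m W' (J - {(i, j)})"
      using complement_shrink[OF J j] by blast
    have "(i, j) \<in> positions m" using J j by (auto simp: complement_def)
    then have "positions m - (J - {(i, j)}) = insert (i, j) ?K" by blast
    then have "Sn_generated_submodule n r (Sn_dsum m S) W'"
      using lt le j unfolding generated_submodule_iff[OF char W'(2)]
      by (simp add: fibre_card_insert[OF finK] Suc_le_eq)
    then show False using top[of W'] W'(1) by blast
  qed
  then have "fibre_card ?K = (\<lambda>i. min (m i) (r * Sn_dim (S i)))" by blast
  then show ?thesis using complement_iso[OF J] by simp
qed

text \<open>
  The first \<open>min (m i) (r * Sn_dim (S i))\<close> copies of each \<open>S i\<close> span a maximal submodule: if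
  \<open>W'\<close> contains them and is generated by \<open>r\<close> elements, a complement \<open>J\<close> of \<open>W'\<close> avoids their positions,
  and the bound on the multiplicities of \<open>W'\<close> forces \<open>J\<close> to consist of all other positions.
  So \<open>J\<close> is a complement of both submodules, and they are equal.
\<close>

lemma maximal_generated_submodule_dsum_exists:
  assumes char: "CHAR('k) = 0 \<or> CHAR('k) > n"
  shows "\<exists>W. Sn_maximal_generated_submodule n r (Sn_dsum m S) W"
proof -
  let ?D = "Sn_dsum m S" and ?l = "\<lambda>i. min (m i) (r * Sn_dim (S i))"
  let ?K = "positions ?l" and ?W = "copies m (positions ?l)"
  have K: "?K \<subseteq> positions m" by (auto simp: positions_def)
  note W = complement_copies[OF K]
  have KK: "positions m - (positions m - ?K) = ?K" using K by blast
  have gen: "Sn_generated_submodule n r ?D ?W"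
    unfolding generated_submodule_iff[OF char W] KK by (simp add: fibre_card_positions)
  have "W' = ?W" if gen': "Sn_generated_submodule n r ?D W'" and sub: "?W \<subseteq> W'" for W'
  proof -
    obtain J where J: "complement m W' J"
      using exists_complement gen' by (auto simp: Sn_generated_submodule_def)
    have fin: "finite (positions m - J)" using finite_positions by blast
    have "a \<notin> J" if a: "a \<in> ?K" for a
    proof
      assume "a \<in> J"
      obtain x where x: "x \<in> underlying (S (fst a))" "x \<noteq> 0" using ex_nonzero by blast
      have "a \<in> positions m" using K a by blast
      then have "single a x \<in> W' \<inter> copies m J"
        using sub a \<open>a \<in> J\<close> x by (auto intro: single_mem_copies)
      then have "single a x a = 0" using J by (auto simp: complement_def)
      then show False using x by (simp add: single_def)
    qed
    then have sub': "?K \<subseteq> positions m - J" using K by blast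
    have "(i, j) \<in> ?K" if ij: "(i, j) \<in> positions m - J" for i j
    proof -
      have "fibre_card (positions m - J) i \<le> ?l i"
        using gen' generated_submodule_iff[OF char J] fibre_card_mono[OF finite_positions, of "positions m - J" m i]
        by (simp add: fibre_card_positions)
      then have "card {j. (i, j) \<in> positions m - J} \<le> card {j. (i, j) \<in> ?K}"
        using fibre_card_positions[of ?l i] by (simp add: fibre_card_def)
      then have "{j. (i, j) \<in> ?K} = {j. (i, j) \<in> positions m - J}"
        using sub' by (intro card_seteq finite_fibre[OF fin]) auto
      then show ?thesis using ij by blast
    qed
    then have "?K = positions m - J" using sub' by auto
    then have "positions m - ?K = J" using J by (auto simp: complement_def)
    then show ?thesis using complement_modular[OF W _ sub] J by simp
  qed
  then show ?thesis using gen unfolding Sn_maximal_generated_submodule_def by blast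
qed

end

lemma generated_submodule_image:
  assumes M: "Sn_module n M" and N: "Sn_module n N" and h: "Sn_hom n M N h"
    and inj: "\<And>u. u \<in> underlying M \<Longrightarrow> g (h u) = u"
    and W: "Sn_submodule n M W"
  shows "Sn_submodule n N (h ` W)"
    and "Sn_iso n (M\<lparr>underlying := W\<rparr>) (N\<lparr>underlying := h ` W\<rparr>)"
    and "Sn_generated_submodule n r M W \<Longrightarrow> Sn_generated_submodule n r N (h ` W)"
proof -
  show sub: "Sn_submodule n N (h ` W)" by (rule Sn_hom_image[OF M N h W])
  have WU: "W \<subseteq> underlying M" using W by (simp add: Sn_submodule_def)
  have "inj_on h W" by (rule inj_on_inverseI[where g = g]) (use inj WU in auto)
  then show iso: "Sn_iso n (M\<lparr>underlying := W\<rparr>) (N\<lparr>underlying := h ` W\<rparr>)"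
    using h WU unfolding Sn_iso_def Sn_hom_def
    by (intro exI[of _ h]) (auto simp: bij_betw_def subset_iff)
  show "Sn_generated_submodule n r N (h ` W)" if "Sn_generated_submodule n r M W"
    using that sub Sn_generated_iso[OF Sn_submodule_module[OF M W] Sn_submodule_module[OF N sub] iso]
    by (simp add: Sn_generated_submodule_def)
qed

text \<open>
  Larger submodules of \<open>N\<close> are pulled back by \<open>g\<close> and compared with \<open>W\<close>.
\<close>

lemma maximal_generated_submodule_image:
  assumes M: "Sn_module n M" and N: "Sn_module n N"
    and h: "Sn_hom n M N h" and g: "Sn_hom n N M g"
    and gh: "\<And>u. u \<in> underlying M \<Longrightarrow> g (h u) = u" and hg: "\<And>v. v \<in> underlying N \<Longrightarrow> h (g v) = v"
    and W: "Sn_maximal_generated_submodule n r M W"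
  shows "Sn_maximal_generated_submodule n r N (h ` W)"
  unfolding Sn_maximal_generated_submodule_def
proof (intro conjI allI impI)
  have gen: "Sn_generated_submodule n r M W"
    and top: "\<And>W'. \<lbrakk>Sn_generated_submodule n r M W'; W \<subseteq> W'\<rbrakk> \<Longrightarrow> W' = W"
    using W by (auto simp: Sn_maximal_generated_submodule_def)
  have sub: "Sn_submodule n M W" using gen by (simp add: Sn_generated_submodule_def)
  show "Sn_generated_submodule n r N (h ` W)"
    by (rule generated_submodule_image(3)[where g = g, OF M N h gh sub gen])
  fix Y assume Y: "Sn_generated_submodule n r N Y" "h ` W \<subseteq> Y"
  have subY: "Sn_submodule n N Y" using Y by (simp add: Sn_generated_submodule_def)
  have "W \<subseteq> g ` Y"
  proof
    fix w assume "w \<in> W"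
    then have "w = g (h w)" "h w \<in> Y" using gh sub Y(2) by (auto simp: Sn_submodule_def)
    then show "w \<in> g ` Y" by blast
  qed
  moreover have "Sn_generated_submodule n r M (g ` Y)"
    by (rule generated_submodule_image(3)[where g = h, OF N M g hg subY Y(1)])
  ultimately have "g ` Y = W" by (intro top)
  moreover have "h ` (g ` Y) = Y"
    using hg subY by (force simp: Sn_submodule_def image_image)
  ultimately show "Y = h ` W" by simp
qed

theorem proposition2p6:
  fixes n r :: nat
    and V :: "('k::field, 'v::ab_group_add) perm_module"
    and S :: "'i::finite \<Rightarrow> ('k, 'w::ab_group_add) perm_module"
    and m :: "'i \<Rightarrow> nat"
  assumes "infinite (UNIV :: 'k set)"
    and "CHAR('k) = 0 \<or> CHAR('k) > n"
    and "Sn_module n V"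
    and "Sn_finitely_generated n V"
    and "Sn_simple_reps n S"
    and "Sn_iso n V (Sn_dsum m S)"
  shows "(\<forall>W. Sn_maximal_generated_submodule n r V W \<longrightarrow>
            Sn_iso n (V\<lparr>underlying := W\<rparr>) (Sn_dsum (\<lambda>i. min (m i) (r * Sn_dim (S i))) S))
       \<and> (\<exists>W. Sn_maximal_generated_submodule n r V W)
       \<and> (\<forall>W W'. Sn_maximal_generated_submodule n r V W \<longrightarrow>
            Sn_maximal_generated_submodule n r V W' \<longrightarrow>
            Sn_iso n (V\<lparr>underlying := W\<rparr>) (V\<lparr>underlying := W'\<rparr>))"
proof -
  note char = assms(2) and V = assms(3)
  interpret distinct_simples n S
    using assms(5) by unfold_locales (auto simp: Sn_simple_reps_def)
  let ?D = "Sn_dsum m S" and ?E = "Sn_dsum (\<lambda>i. min (m i) (r * Sn_dim (S i))) S"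
  obtain h g where h: "Sn_hom n V ?D h" and g: "Sn_hom n ?D V g"
    and gh: "\<And>u. u \<in> underlying V \<Longrightarrow> g (h u) = u" and hg: "\<And>v. v \<in> underlying ?D \<Longrightarrow> h (g v) = v"
    using Sn_isoE[OF V assms(6)] by metis
  have sub: "Sn_submodule n V W" if "Sn_maximal_generated_submodule n r V W" for W
    using that by (simp add: Sn_maximal_generated_submodule_def Sn_generated_submodule_def)
  have iso: "Sn_iso n (V\<lparr>underlying := W\<rparr>) ?E" if W: "Sn_maximal_generated_submodule n r V W" for W
    using Sn_iso_trans[OF Sn_submodule_module[OF V sub[OF W]]
        generated_submodule_image(2)[where g = g, OF V dsum_module h gh sub[OF W]]]
      maximal_generated_submodule_dsum_iso[OF char
        maximal_generated_submodule_image[where g = g, OF V dsum_module h g gh hg W]]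
    by blast
  have "\<exists>W. Sn_maximal_generated_submodule n r V W"
    using maximal_generated_submodule_dsum_exists[OF char]
      maximal_generated_submodule_image[where g = h, OF dsum_module V g h hg gh] by blast
  moreover have "Sn_iso n (V\<lparr>underlying := W\<rparr>) (V\<lparr>underlying := W'\<rparr>)"
    if W: "Sn_maximal_generated_submodule n r V W" and W': "Sn_maximal_generated_submodule n r V W'" for W W'
    using Sn_iso_trans[OF Sn_submodule_module[OF V sub[OF W]] iso[OF W]]
      Sn_iso_sym[OF Sn_submodule_module[OF V sub[OF W']] iso[OF W']] by blast
  ultimately show ?thesis using iso by blast
qed

end
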